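(* Let $\mathcal{F}$ be an $n\times m$ Ferrers diagram and let $2\le d\le n$ and $1\le k\le|\mathcal{F}|$ be integers with $\kappa(\mathcal{F},d)\ge1$. Then, with limits taken as $q\to+\infty$ over prime powers: (1) if $k\le\tau(\mathcal{F},d-1)$, then $\lim_{q\to+\infty}\delta_q(\mathcal{F},k,d)=1$; (2) if $k\ge\tau(\mathcal{F},d-1)+2$, then $\lim_{q\to+\infty}\delta_q(\mathcal{F},k,d)=0$; (3) if $k=\tau(\mathcal{F},d-1)+1$, then $\limsup_{q\to+\infty}\delta_q(\mathcal{F},k,d)\le 1/2$.
   Context: $q$ denotes a prime power and $\mathbb{F}_q$ the finite field with $q$ elements; $[i]=\{1,\dots,i\}$. An $n\times m$ Ferrers diagram is a subset $\mathcal{F}\subseteq[n]\times[m]$ such that $(1,1),(n,m)\in\mathcal{F}$; if $(i,j)\in\mathcal{F}$ and $j<m$ then $(i,j+1)\in\mathcal{F}$; and if $(i,j)\in\mathcal{F}$ and $i>1$ then $(i-1,j)\in\mathcal{F}$. Let $c_j=|\{i:(i,j)\in\mathcal{F}\}|$. For an integer $d\ge1$ and $0\le j\le d-1$ set $\kappa_j(\mathcal{F},d)=\sum_{t=1}^{m-d+1+j}\max\{c_t-j,0\}$ (an empty sum being $0$) and $\kappa(\mathcal{F},d)=\min_{0\le j\le d-1}\kappa_j(\mathcal{F},d)$. $\mathbb{F}_q[\mathcal{F}]$ is the space of $n\times m$ matrices over $\mathbb{F}_q$ whose entries outside $\mathcal{F}$ are zero; an $[\mathcal{F},d]_q$-space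 is an $\mathbb{F}_q$-linear subspace $\mathcal{C}\le\mathbb{F}_q[\mathcal{F}]$ with $\mathrm{rk}(M)\ge d$ for all nonzero $M\in\mathcal{C}$. With $\binom{a}{b}_q=\prod_{i=0}^{b-1}\frac{q^a-q^i}{q^b-q^i}$ the $q$-binomial coefficient, $\delta_q(\mathcal{F},k,d)$ is the number of $k$-dimensional $[\mathcal{F},d]_q$-spaces divided by $\binom{|\mathcal{F}|}{k}_q$. A non-attacking rook placement is a subset $C\subseteq[n]\times[m]$ with no two elements sharing a row or column index; for such $C\subseteq\mathcal{F}$, $\mathrm{inv}(C,\mathcal{F})$ is the number of $(a,b)\in\mathcal{F}$ such that there is no $(i,j)\in C$ with ($b=j$ and $a\le i$) or ($a=i$ and $b\ge j$). $R_q(\mathcal{F},r)=\sum_C q^{\mathrm{inv}(C,\mathcal{F})}$ over non-attacking rook placements $C\subseteq\mathcal{F}$ with $|C|=r$, and $\tau(\mathcal{F},r)$ is its trailing degree. *)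

theory Defs
  imports
    "Jordan_Normal_Form.Missing_VectorSpace"
    "HOL-Computational_Algebra.Polynomial"
    "HOL-Number_Theory.Prime_Powers"
    "HOL-Library.Extended_Real"
begin

text \<open>
  Cells are pairs (row, column), both counted from 1.
\<close>

definition ferrers_diagram :: "nat \<Rightarrow> nat \<Rightarrow> (nat \<times> nat) set \<Rightarrow> bool" where
  "ferrers_diagram n m F \<longleftrightarrow>
     F \<subseteq> {1..n} \<times> {1..m} \<and> (1, 1) \<in> F \<and> (n, m) \<in> F \<and>
     (\<forall>i j. (i, j) \<in> F \<and> j < m \<longrightarrow> (i, j + 1) \<in> F) \<and>
     (\<forall>i j. (i, j) \<in> F \<and> i > 1 \<longrightarrow> (i - 1, j) \<in> F)"

definition col_height :: "(nat \<times> nat) set \<Rightarrow> nat \<Rightarrow> nat" where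
  "col_height F j = card {i. (i, j) \<in> F}"

text \<open>
  Truncated subtraction on the naturals is intended in both places: it renders
  $\max\{c_t - j, 0\}$, and it makes the sum empty when $m - d + 1 + j \le 0$.
\<close>

definition kappa_j :: "nat \<Rightarrow> (nat \<times> nat) set \<Rightarrow> nat \<Rightarrow> nat \<Rightarrow> nat" where
  "kappa_j m F d j = (\<Sum>t = 1..m + 1 + j - d. col_height F t - j)"

definition kappa :: "nat \<Rightarrow> (nat \<times> nat) set \<Rightarrow> nat \<Rightarrow> nat" where
  "kappa m F d = Min (kappa_j m F d ` {0..d - 1})"


text \<open>
  The $n \times m$ matrices over a field \<open>K\<close> form the vector space of functions
  from $[n] \times [m]$ to \<open>K\<close>; such functions are \<open>undefined\<close> outside the index set.
\<close>

definition mat_space ::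
    "('a, 'b) ring_scheme \<Rightarrow> nat \<Rightarrow> nat \<Rightarrow> ('a, nat \<times> nat \<Rightarrow> 'a) module" where
  "mat_space K n m = ring.func_space K ({1..n} \<times> {1..m})"

definition mat_col :: "nat \<Rightarrow> (nat \<times> nat \<Rightarrow> 'a) \<Rightarrow> nat \<Rightarrow> (nat \<Rightarrow> 'a)" where
  "mat_col n M j = (\<lambda>i\<in>{1..n}. M (i, j))"

definition subspace_dim ::
    "('a, 'b) ring_scheme \<Rightarrow> ('a, 'c) module \<Rightarrow> 'c set \<Rightarrow> nat" where
  "subspace_dim K V W = vectorspace.dim K (V\<lparr>carrier := W\<rparr>)"

definition mat_rank ::
    "('a, 'b) ring_scheme \<Rightarrow> nat \<Rightarrow> nat \<Rightarrow> (nat \<times> nat \<Rightarrow> 'a) \<Rightarrow> nat" where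
  "mat_rank K n m M =
     (let V = ring.func_space K {1..n}
      in subspace_dim K V (LinearCombinations.module.span K V (mat_col n M ` {1..m})))"

definition supported_mats ::
    "('a, 'b) ring_scheme \<Rightarrow> nat \<Rightarrow> nat \<Rightarrow> (nat \<times> nat) set \<Rightarrow> (nat \<times> nat \<Rightarrow> 'a) set" where
  "supported_mats K n m F =
     {M \<in> carrier (mat_space K n m). \<forall>x \<in> {1..n} \<times> {1..m} - F. M x = \<zero>\<^bsub>K\<^esub>}"

definition ferrers_code ::
    "('a, 'b) ring_scheme \<Rightarrow> nat \<Rightarrow> nat \<Rightarrow> (nat \<times> nat) set \<Rightarrow> nat \<Rightarrow>
     (nat \<times> nat \<Rightarrow> 'a) set \<Rightarrow> bool" where
  "ferrers_code K n m F d C \<longleftrightarrow>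
     VectorSpace.subspace K C (mat_space K n m) \<and> C \<subseteq> supported_mats K n m F \<and>
     (\<forall>M\<in>C. M \<noteq> \<zero>\<^bsub>mat_space K n m\<^esub> \<longrightarrow> d \<le> mat_rank K n m M)"

definition q_binomial :: "nat \<Rightarrow> nat \<Rightarrow> nat \<Rightarrow> real" where
  "q_binomial q a b = (\<Prod>i<b. (real q ^ a - real q ^ i) / (real q ^ b - real q ^ i))"

text \<open>Here $q$ is the cardinality of the field \<open>K\<close>.\<close>

definition code_density ::
    "('a, 'b) ring_scheme \<Rightarrow> nat \<Rightarrow> nat \<Rightarrow> (nat \<times> nat) set \<Rightarrow> nat \<Rightarrow> nat \<Rightarrow> real" where
  "code_density K n m F k d =
     real (card {C. ferrers_code K n m F d C \<and> subspace_dim K (mat_space K n m) C = k})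
     / q_binomial (card (carrier K)) (card F) k"


definition non_attacking :: "(nat \<times> nat) set \<Rightarrow> bool" where
  "non_attacking C \<longleftrightarrow> (\<forall>x\<in>C. \<forall>y\<in>C. x \<noteq> y \<longrightarrow> fst x \<noteq> fst y \<and> snd x \<noteq> snd y)"

definition rook_inv :: "(nat \<times> nat) set \<Rightarrow> (nat \<times> nat) set \<Rightarrow> nat" where
  "rook_inv C F =
     card {(a, b) \<in> F. \<not> (\<exists>(i, j)\<in>C. (b = j \<and> a \<le> i) \<or> (a = i \<and> b \<ge> j))}"

definition q_rook_poly :: "(nat \<times> nat) set \<Rightarrow> nat \<Rightarrow> int poly" where
  "q_rook_poly F r =
     (\<Sum>C | C \<subseteq> F \<and> non_attacking C \<and> card C = r. Polynomial.monom 1 (rook_inv C F))"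

text \<open>Meaningful only for nonzero polynomials.\<close>

definition trailing_degree :: "'a::zero poly \<Rightarrow> nat" where
  "trailing_degree p = (LEAST i. Polynomial.coeff p i \<noteq> 0)"

definition tau :: "(nat \<times> nat) set \<Rightarrow> nat \<Rightarrow> nat" where
  "tau F r = trailing_degree (q_rook_poly F r)"


text \<open>The filter of \<open>q \<rightarrow> \<infinity>\<close> through prime powers.\<close>

definition prime_powers_at_top :: "nat filter" where
  "prime_powers_at_top = inf at_top (principal {q. primepow q})"

end

theory Submission
  imports Defs "HOL-Analysis.Convex"
begin

text \<open>
  Let \<open>L\<close> be the set of nonzero matrices supported on \<open>F\<close> of rank less than \<open>d\<close>, let \<open>\<tau>\<close> be
  \<open>tau F (d - 1)\<close>, and let \<open>E\<close> be the expected number of lines of a uniformly random \<open>k\<close>-space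
  that are contained in \<open>L \<union> {0}\<close>. The density is the probability that the random space misses
  \<open>L\<close>; it is at least \<open>1 - E\<close> by the union bound and at most \<open>1 / (1 + E)\<close> by the second moment
  inequality.

  To estimate \<open>card L\<close>, build a matrix column by column, from the shortest column to the longest.
  If the columns so far have rank \<open>r\<close> and the next one has height \<open>c\<close>, there are \<open>q^r\<close> choices
  that keep the rank and \<open>q^c - q^r\<close> that raise it. Rook placements obey the same recursion: leaving the
  new column empty contributes \<open>c - r\<close> to \<open>rook_inv\<close>, and a rook in the lowest free row contributes nothing.
  Hence \<open>card L\<close> lies between \<open>(1 - 1/q)^m\<close> and \<open>d * 2^m\<close> times \<open>q^(card F - \<tau>)\<close>, so that \<open>E\<close>
  has order \<open>q^(k - 1 - \<tau>)\<close>, with a lower bound that is asymptotically sharp enough for \<open>k = \<tau> + 1\<close>.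
\<close>

section \<open>Vector spaces over finite fields\<close>

lemma (in abelian_group) minus_eq_minus_if_add_eq:
  assumes "u \<in> carrier G" "x \<in> carrier G" "u' \<in> carrier G" "y \<in> carrier G"
    and "u \<oplus> x = u' \<oplus> y"
  shows "u' \<ominus> u = x \<ominus> y"
proof -
  have "u' = (u' \<oplus> y) \<oplus> (\<ominus> y)" using assms(1-4) by (simp add: a_assoc r_neg)
  also have "\<dots> = u \<oplus> x \<oplus> (\<ominus> y)" using assms(5) by simp
  finally have "\<ominus> u \<oplus> u' = \<ominus> u \<oplus> (u \<oplus> (x \<oplus> (\<ominus> y)))" using assms(1-4) by (simp add: a_assoc)
  then show ?thesis using assms by (simp add: a_minus_def r_neg1 a_comm)
qed

locale finite_vectorspace = vectorspace K V
  for K :: "('a, 'b) ring_scheme" and V :: "('a, 'c) module" +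
  assumes finite_scalars: "finite (carrier K)"
    and finite_vectors: "finite (carrier V)"
begin

abbreviation q :: nat where "q \<equiv> card (carrier K)"

text \<open>The subspace generated by \<open>U\<close> and \<open>v\<close>, given as an explicit
  image of \<open>U \<times> carrier K\<close> so that its cardinality is a matter of injectivity.
  For \<open>U\<close> the zero space it is the line through \<open>v\<close>.\<close>

definition adjoin :: "'c set \<Rightarrow> 'c \<Rightarrow> 'c set" where
  "adjoin U v = (\<lambda>(u, a). u \<oplus>\<^bsub>V\<^esub> a \<odot>\<^bsub>V\<^esub> v) ` (U \<times> carrier K)"

lemma q_ge_2: "2 \<le> q"
proof -
  have "{\<zero>\<^bsub>K\<^esub>, \<one>\<^bsub>K\<^esub>} \<subseteq> carrier K" by simp
  from card_mono[OF finite_scalars this] show ?thesis by simp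
qed

lemma subspaceI:
  assumes "W \<subseteq> carrier V" "\<zero>\<^bsub>V\<^esub> \<in> W"
    and "\<And>v w. v \<in> W \<Longrightarrow> w \<in> W \<Longrightarrow> v \<oplus>\<^bsub>V\<^esub> w \<in> W"
    and "\<And>a v. a \<in> carrier K \<Longrightarrow> v \<in> W \<Longrightarrow> a \<odot>\<^bsub>V\<^esub> v \<in> W"
  shows "VectorSpace.subspace K W V"
  unfolding VectorSpace.subspace_def submodule_def
  using assms vectorspace_axioms module_axioms by blast

lemma subspaceD:
  assumes "VectorSpace.subspace K W V"
  shows "W \<subseteq> carrier V" "\<zero>\<^bsub>V\<^esub> \<in> W"
    "\<And>v w. v \<in> W \<Longrightarrow> w \<in> W \<Longrightarrow> v \<oplus>\<^bsub>V\<^esub> w \<in> W"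
    "\<And>a v. a \<in> carrier K \<Longrightarrow> v \<in> W \<Longrightarrow> a \<odot>\<^bsub>V\<^esub> v \<in> W"
    "\<And>v. v \<in> W \<Longrightarrow> \<ominus>\<^bsub>V\<^esub> v \<in> W"
    "\<And>v w. v \<in> W \<Longrightarrow> w \<in> W \<Longrightarrow> v \<ominus>\<^bsub>V\<^esub> w \<in> W"
proof -
  have sm: "submodule K W V" using assms by (rule is_module)
  show 1: "W \<subseteq> carrier V" "\<zero>\<^bsub>V\<^esub> \<in> W"
    "\<And>v w. v \<in> W \<Longrightarrow> w \<in> W \<Longrightarrow> v \<oplus>\<^bsub>V\<^esub> w \<in> W"
    "\<And>a v. a \<in> carrier K \<Longrightarrow> v \<in> W \<Longrightarrow> a \<odot>\<^bsub>V\<^esub> v \<in> W"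
    using sm unfolding submodule_def by blast+
  show 2: "\<ominus>\<^bsub>V\<^esub> v \<in> W" if "v \<in> W" for v
  proof -
    have "\<ominus>\<^bsub>V\<^esub> v = (\<ominus>\<^bsub>K\<^esub> \<one>\<^bsub>K\<^esub>) \<odot>\<^bsub>V\<^esub> v"
      using that 1(1) by (metis smult_minus_1 subsetD)
    with 1(4) that show ?thesis by simp
  qed
  show "v \<ominus>\<^bsub>V\<^esub> w \<in> W" if "v \<in> W" "w \<in> W" for v w
    using 1(3) 2 that by (simp add: a_minus_def)
qed

lemma finite_subspace: "VectorSpace.subspace K W V \<Longrightarrow> finite W"
  using subspaceD(1) finite_vectors finite_subset by blast

section \<open>Enlarging a subspace by one vector\<close>

lemma adjoin_subspace:
  assumes U: "VectorSpace.subspace K U V" and v: "v \<in> carrier V"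
  shows "VectorSpace.subspace K (adjoin U v) V"
proof (rule subspaceI)
  note D = subspaceD[OF U]
  show "adjoin U v \<subseteq> carrier V" using D(1) v by (auto simp: adjoin_def)
  show "\<zero>\<^bsub>V\<^esub> \<in> adjoin U v"
    unfolding adjoin_def
    by (rule image_eqI[of _ _ "(\<zero>\<^bsub>V\<^esub>, \<zero>\<^bsub>K\<^esub>)"]) (use D(2) v in auto)
next
  note D = subspaceD[OF U]
  fix x y assume "x \<in> adjoin U v" "y \<in> adjoin U v"
  then obtain u a u' a' where *: "x = u \<oplus>\<^bsub>V\<^esub> a \<odot>\<^bsub>V\<^esub> v" "y = u' \<oplus>\<^bsub>V\<^esub> a' \<odot>\<^bsub>V\<^esub> v"
    "u \<in> U" "u' \<in> U" "a \<in> carrier K" "a' \<in> carrier K"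
    by (auto simp: adjoin_def)
  have c: "u \<in> carrier V" "u' \<in> carrier V" using * D(1) by auto
  have "x \<oplus>\<^bsub>V\<^esub> y = (u \<oplus>\<^bsub>V\<^esub> u') \<oplus>\<^bsub>V\<^esub> (a \<oplus>\<^bsub>K\<^esub> a') \<odot>\<^bsub>V\<^esub> v"
    using * c v by (simp add: smult_l_distr M.a_ac)
  then show "x \<oplus>\<^bsub>V\<^esub> y \<in> adjoin U v"
    unfolding adjoin_def
    by (intro image_eqI[of _ _ "(u \<oplus>\<^bsub>V\<^esub> u', a \<oplus>\<^bsub>K\<^esub> a')"]) (use * D(3) in auto)
next
  note D = subspaceD[OF U]
  fix b x assume b: "b \<in> carrier K" and "x \<in> adjoin U v"
  then obtain u a where *: "x = u \<oplus>\<^bsub>V\<^esub> a \<odot>\<^bsub>V\<^esub> v" "u \<in> U" "a \<in> carrier K"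
    by (auto simp: adjoin_def)
  have c: "u \<in> carrier V" using * D(1) by auto
  have "b \<odot>\<^bsub>V\<^esub> x = b \<odot>\<^bsub>V\<^esub> u \<oplus>\<^bsub>V\<^esub> (b \<otimes>\<^bsub>K\<^esub> a) \<odot>\<^bsub>V\<^esub> v"
    using * c v b by (simp add: smult_r_distr smult_assoc1)
  then show "b \<odot>\<^bsub>V\<^esub> x \<in> adjoin U v"
    unfolding adjoin_def
    by (intro image_eqI[of _ _ "(b \<odot>\<^bsub>V\<^esub> u, b \<otimes>\<^bsub>K\<^esub> a)"]) (use * D(4) b in auto)
qed

lemma adjoin_superset:
  assumes U: "VectorSpace.subspace K U V" and v: "v \<in> carrier V"
  shows "U \<subseteq> adjoin U v" "v \<in> adjoin U v"
proof -
  note D = subspaceD[OF U]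
  show "U \<subseteq> adjoin U v"
  proof
    fix u assume "u \<in> U"
    then show "u \<in> adjoin U v"
      unfolding adjoin_def using D(1) v
      by (intro image_eqI[of _ _ "(u, \<zero>\<^bsub>K\<^esub>)"]) auto
  qed
  show "v \<in> adjoin U v"
    unfolding adjoin_def using D(2) v
    by (intro image_eqI[of _ _ "(\<zero>\<^bsub>V\<^esub>, \<one>\<^bsub>K\<^esub>)"]) auto
qed

lemma adjoin_subset_iff:
  assumes U: "VectorSpace.subspace K U V" and W: "VectorSpace.subspace K W V" and v: "v \<in> carrier V"
  shows "adjoin U v \<subseteq> W \<longleftrightarrow> U \<subseteq> W \<and> v \<in> W"
proof
  show "adjoin U v \<subseteq> W \<Longrightarrow> U \<subseteq> W \<and> v \<in> W"
    using adjoin_superset[OF U v] by blast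
  show "U \<subseteq> W \<and> v \<in> W \<Longrightarrow> adjoin U v \<subseteq> W"
    using subspaceD(3,4)[OF W] by (auto simp: adjoin_def)
qed

text \<open>If a vector had two representations with different coefficients of \<open>v\<close>,
  dividing by the difference of these coefficients would put \<open>v\<close> into
  \<open>U\<close>.\<close>

lemma card_adjoin:
  assumes U: "VectorSpace.subspace K U V" and v: "v \<in> carrier V" "v \<notin> U"
  shows "card (adjoin U v) = q * card U"
proof -
  note D = subspaceD[OF U]
  have "inj_on (\<lambda>(u, a). u \<oplus>\<^bsub>V\<^esub> a \<odot>\<^bsub>V\<^esub> v) (U \<times> carrier K)"
  proof (rule inj_onI, clarsimp)
    fix u a u' a'
    assume h: "u \<in> U" "a \<in> carrier K" "u' \<in> U" "a' \<in> carrier K"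
      and eq: "u \<oplus>\<^bsub>V\<^esub> a \<odot>\<^bsub>V\<^esub> v = u' \<oplus>\<^bsub>V\<^esub> a' \<odot>\<^bsub>V\<^esub> v"
    have c: "u \<in> carrier V" "u' \<in> carrier V" using h D(1) by auto
    let ?b = "a \<ominus>\<^bsub>K\<^esub> a'"
    have b: "?b \<in> carrier K" using h by simp
    have "u' \<ominus>\<^bsub>V\<^esub> u = a \<odot>\<^bsub>V\<^esub> v \<ominus>\<^bsub>V\<^esub> a' \<odot>\<^bsub>V\<^esub> v"
      using c h v eq by (intro M.minus_eq_minus_if_add_eq) auto
    also have "\<dots> = ?b \<odot>\<^bsub>V\<^esub> v"
      using h v by (simp add: a_minus_def smult_l_distr smult_l_minus)
    finally have e: "u' \<ominus>\<^bsub>V\<^esub> u = ?b \<odot>\<^bsub>V\<^esub> v" .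
    have "?b = \<zero>\<^bsub>K\<^esub>"
    proof (rule ccontr)
      assume nz: "?b \<noteq> \<zero>\<^bsub>K\<^esub>"
      then have "v = inv\<^bsub>K\<^esub> ?b \<odot>\<^bsub>V\<^esub> (u' \<ominus>\<^bsub>V\<^esub> u)"
        using mult_inverse[OF b v(1) e[symmetric]] by simp
      moreover have "inv\<^bsub>K\<^esub> ?b \<in> carrier K" using b nz by (simp add: field_Units)
      ultimately have "v \<in> U" using D(4)[OF _ D(6)[OF h(3,1)]] by simp
      with v show False by simp
    qed
    then have aa: "a = a'" using h by simp
    with eq show "u = u' \<and> a = a'" using c h v by (simp add: M.add.m_comm)
  qed
  then show ?thesis
    unfolding adjoin_def by (simp add: card_image card_cartesian_product)
qed

lemma adjoin_absorb:
  assumes U: "VectorSpace.subspace K U V" and v: "v \<in> U"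
  shows "adjoin U v = U"
proof -
  have "v \<in> carrier V" using U v subspaceD(1) by blast
  then show ?thesis using adjoin_subset_iff[OF U U] adjoin_superset[OF U] v by blast
qed

section \<open>Cardinalities of spans and subspaces as powers of \<open>q\<close>\<close>

lemma span_insert_eq_adjoin:
  assumes S: "S \<subseteq> carrier V" and v: "v \<in> carrier V"
  shows "span (insert v S) = adjoin (span S) v"
proof
  have sub: "VectorSpace.subspace K (span S) V" by (rule span_is_subspace[OF S])
  have subi: "VectorSpace.subspace K (span (insert v S)) V" by (rule span_is_subspace) (use S v in auto)
  show "span (insert v S) \<subseteq> adjoin (span S) v"
  proof (rule span_is_subset)
    show "insert v S \<subseteq> adjoin (span S) v"
      using adjoin_superset[OF sub v] in_own_span[OF S] by auto
    show "submodule K (adjoin (span S) v) V"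
      using adjoin_subspace[OF sub v] by simp
  qed
  show "adjoin (span S) v \<subseteq> span (insert v S)"
    unfolding adjoin_subset_iff[OF sub subi v]
    using span_is_monotone[of S "insert v S"] in_own_span[of "insert v S"] S v by auto
qed

lemma card_span_insert:
  assumes S: "S \<subseteq> carrier V" and v: "v \<in> carrier V"
  shows "card (span (insert v S)) = (if v \<in> span S then card (span S) else q * card (span S))"
  using span_insert_eq_adjoin[OF S v] adjoin_absorb[OF span_is_subspace[OF S]]
    card_adjoin[OF span_is_subspace[OF S] v] by simp

text \<open>Each new vector of an independent set lies outside the span of the earlier ones, so it
  multiplies the cardinality by \<open>q\<close>.\<close>

lemma card_span_lin_indpt:
  assumes "finite A" "A \<subseteq> carrier V" "lin_indpt A"
  shows "card (span A) = q ^ card A"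
  using assms
proof (induction A rule: finite_induct)
  case empty
  then show ?case by (simp add: span_empty)
next
  case (insert v A)
  have ind: "lin_indpt A" using insert.prems subset_li_is_li by blast
  have "v \<notin> span A"
    using lin_dep_iff_in_span[OF _ ind, of v] insert by auto
  then show ?case using insert ind by (simp add: card_span_insert)
qed

lemma card_carrier_eq_power_dim: "card (carrier V) = q ^ dim"
proof -
  have "gen_set (carrier V)"
    using in_own_span[of "carrier V"] span_is_subspace[of "carrier V"] subspaceD(1) by blast
  then have "fin_dim" unfolding fin_dim_def using finite_vectors by blast
  then obtain B where B: "finite B" "basis B" using finite_basis_exists by blast
  then show ?thesis
    using dim_basis[OF B] card_span_lin_indpt[of B] unfolding basis_def by simp
qed

text \<open>Lets the cardinality \<open>q ^ k\<close> stand for dimension \<open>k\<close>, which is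
  how subspaces are counted from here on.\<close>

lemma card_subspace:
  assumes "VectorSpace.subspace K W V"
  shows "card W = q ^ subspace_dim K V W"
proof -
  interpret W: finite_vectorspace K "vs W"
    unfolding finite_vectorspace_def finite_vectorspace_axioms_def
    using subspace_is_vs[OF assms] finite_scalars finite_subspace[OF assms] by simp
  show ?thesis using W.card_carrier_eq_power_dim by (simp add: subspace_dim_def)
qed

text \<open>Dimension \<open>k\<close> is encoded as cardinality \<open>q ^ k\<close>. The lower
  bound \<open>S\<close> drives the induction; with \<open>S\<close> the zero space, a line or a
  plane it describes all \<open>k\<close>-spaces in \<open>X\<close>, or those through one or two
  given points.\<close>

definition spaces_between :: "'c set \<Rightarrow> 'c set \<Rightarrow> nat \<Rightarrow> 'c set set" where
  "spaces_between S X k =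
     {U. VectorSpace.subspace K U V \<and> S \<subseteq> U \<and> U \<subseteq> X \<and> card U = q ^ k}"

lemma finite_spaces_between: "finite (spaces_between S X k)"
proof -
  have "spaces_between S X k \<subseteq> Pow (carrier V)"
    unfolding spaces_between_def using subspaceD(1) by blast
  then show ?thesis using finite_vectors by (meson finite_Pow_iff finite_subset)
qed

lemma spaces_between_adjoin:
  assumes "VectorSpace.subspace K S V" "v \<in> carrier V"
  shows "spaces_between (adjoin S v) X k = {U \<in> spaces_between S X k. v \<in> U}"
  unfolding spaces_between_def using adjoin_subset_iff[OF assms(1) _ assms(2)] by blast

lemma real_power_q_less: "i < j \<Longrightarrow> real q ^ i < real q ^ j"
  using q_ge_2 by (intro power_strict_increasing) auto

text \<open>Double counting of the pairs of a space \<open>U\<close> in question and a vector of \<open>U - S\<close>.\<close>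
lemma card_spaces_between:
  assumes X: "VectorSpace.subspace K X V" "card X = q ^ N"
    and S: "VectorSpace.subspace K S V" "S \<subseteq> X" "card S = q ^ s" "s \<le> k" and k: "k \<le> N"
  shows "real (card (spaces_between S X k)) =
    (\<Prod>i = s..<k. (real q ^ N - real q ^ i) / (real q ^ k - real q ^ i))"
  using \<open>s \<le> k\<close> S(1-3)
\<comment> \<open>The dimension of \<open>S\<close> descends from \<open>k\<close>; at
  \<open>s = k\<close> only \<open>S\<close> itself remains and the product is empty.\<close>
proof (induction arbitrary: S rule: inc_induct)
  case base
  have "spaces_between S X k = {S}"
  proof -
    have "U = S" if "VectorSpace.subspace K U V" "S \<subseteq> U" "card U = q ^ k" for U
      using card_subset_eq[OF finite_subspace[OF that(1)] that(2)] that(3) base by simp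
    then show ?thesis unfolding spaces_between_def using base by auto
  qed
  then show ?case by simp
next
  case (step s)
  let ?G = "\<Prod>i = Suc s..<k. (real q ^ N - real q ^ i) / (real q ^ k - real q ^ i)"
  let ?B = "spaces_between S X k"
  have Xc: "X \<subseteq> carrier V" using subspaceD(1)[OF X(1)] .
  have fX: "finite X" using finite_subspace[OF X(1)] .
  have fS: "finite S" using fX step.prems finite_subset by blast
  \<comment> \<open>The count does not depend on \<open>v\<close>: it is the induction hypothesis
    for the space generated by \<open>S\<close> and \<open>v\<close>.\<close>
  have G: "real (card {U \<in> ?B. v \<in> U}) = ?G" if v: "v \<in> X - S" for v
  proof -
    have vc: "v \<in> carrier V" using v Xc by blast
    have "adjoin S v \<subseteq> X" using adjoin_subset_iff[OF step.prems(1) X(1) vc] step.prems v by simp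
    moreover have "card (adjoin S v) = q ^ Suc s"
      using card_adjoin[OF step.prems(1) vc] v step.prems by simp
    ultimately have "real (card (spaces_between (adjoin S v) X k)) = ?G"
      using step.IH adjoin_subspace[OF step.prems(1) vc] by blast
    then show ?thesis using spaces_between_adjoin[OF step.prems(1) vc] by simp
  qed
  have "real (card ?B) * (real q ^ k - real q ^ s) = real (\<Sum>U\<in>?B. card {v \<in> X - S. v \<in> U})"
  proof -
    have "real (card {v \<in> X - S. v \<in> U}) = real q ^ k - real q ^ s" if "U \<in> ?B" for U
    proof -
      have U: "U \<subseteq> X" "S \<subseteq> U" "card U = q ^ k" using that by (auto simp: spaces_between_def)
      have "{v \<in> X - S. v \<in> U} = U - S" using U by blast
      moreover have "card (U - S) = q ^ k - q ^ s"
        using card_Diff_subset[OF fS U(2)] U step.prems by simp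
      moreover have "q ^ s \<le> q ^ k" using q_ge_2 step.hyps by (intro power_increasing) auto
      ultimately show ?thesis by (simp add: of_nat_diff)
    qed
    then show ?thesis by simp
  qed
  also have "\<dots> = (\<Sum>v\<in>X - S. real (card {U \<in> ?B. v \<in> U}))"
  proof -
    have "(\<Sum>U\<in>?B. card {v \<in> X - S. v \<in> U}) = (\<Sum>v\<in>X - S. card {U \<in> ?B. v \<in> U})"
      by (rule sum_multicount_gen[OF finite_spaces_between]) (use fX in auto)
    then show ?thesis by (simp only: of_nat_sum)
  qed
  also have "\<dots> = real (card (X - S)) * ?G" using G by simp
  also have "real (card (X - S)) = real q ^ N - real q ^ s"
  proof -
    have "card (X - S) = q ^ N - q ^ s"
      using card_Diff_subset[OF fS step.prems(2)] X step.prems by simp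
    moreover have "q ^ s \<le> q ^ N" using q_ge_2 step.hyps k by (intro power_increasing) auto
    ultimately show ?thesis by (simp add: of_nat_diff)
  qed
  finally have "real (card ?B) = (real q ^ N - real q ^ s) / (real q ^ k - real q ^ s) * ?G"
    using real_power_q_less[OF step.hyps(2)] by (simp add: field_simps)
  then show ?case using step.hyps by (simp add: prod.atLeast_Suc_lessThan)
qed

end

section \<open>Random subspaces\<close>

locale random_subspace = finite_vectorspace K V
  for K :: "('a, 'b) ring_scheme" and V :: "('a, 'c) module" +
  fixes X L :: "'c set" and N k :: nat
  assumes X: "VectorSpace.subspace K X V" "card X = q ^ N"
    and N: "2 \<le> N" and k: "1 \<le> k" "k \<le> N"
    and L: "L \<subseteq> X - {\<zero>\<^bsub>V\<^esub>}"
begin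

abbreviation spaces :: "'c set set" where
  "spaces \<equiv> spaces_between {\<zero>\<^bsub>V\<^esub>} X k"

definition meeting :: "'c set set" where
  "meeting = {U \<in> spaces. U \<inter> L \<noteq> {}}"

text \<open>When \<open>L\<close> is closed under nonzero scalars, it consists of
  \<open>card L / (q - 1)\<close> punctured lines, and each lies in a uniformly random member of
  \<open>spaces\<close> with probability \<open>point_prob\<close>.\<close>

definition expected_lines :: real where
  "expected_lines = real (card L) * (real q ^ k - 1) / ((real q - 1) * (real q ^ N - 1))"

definition point_prob :: real where
  "point_prob = (real q ^ k - 1) / (real q ^ N - 1)"

lemma zero_subspace: "VectorSpace.subspace K {\<zero>\<^bsub>V\<^esub>} V"
  by (rule subspaceI) auto

lemma X_carrier: "X \<subseteq> carrier V"
  using subspaceD(1)[OF X(1)] .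

lemma finite_X: "finite X"
  using finite_subspace[OF X(1)] .

lemma finite_L: "finite L"
  using finite_X L finite_subset by blast

lemma q_power_gt_1: "0 < i \<Longrightarrow> 1 < real q ^ i"
  using real_power_q_less[of 0 i] by simp

lemma point_prob_pos: "0 < point_prob"
  unfolding point_prob_def using q_power_gt_1[of k] q_power_gt_1[of N] k N by simp

lemma card_spaces: "real (card spaces) = q_binomial q N k"
  using card_spaces_between[OF X zero_subspace _ _ _ k(2), of 0] subspaceD(2)[OF X(1)]
  by (simp add: q_binomial_def atLeast0LessThan)

lemma card_spaces_pos: "0 < real (card spaces)"
  unfolding card_spaces q_binomial_def
  using real_power_q_less k by (intro prod_pos) (simp add: divide_pos_pos)

text \<open>The products that count the spaces through the line of \<open>v\<close> and all spaces
  differ only in the factor for \<open>i = 0\<close>.\<close>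

lemma card_spaces_containing:
  assumes v: "v \<in> L"
  shows "real (card {U \<in> spaces. v \<in> U}) = point_prob * real (card spaces)"
proof -
  have vc: "v \<in> carrier V" "v \<notin> {\<zero>\<^bsub>V\<^esub>}" "v \<in> X" using v L X_carrier by auto
  have sub: "adjoin {\<zero>\<^bsub>V\<^esub>} v \<subseteq> X"
    using adjoin_subset_iff[OF zero_subspace X(1) vc(1)] subspaceD(2)[OF X(1)] vc by simp
  have "real (card {U \<in> spaces. v \<in> U}) =
      (\<Prod>i = 1..<k. (real q ^ N - real q ^ i) / (real q ^ k - real q ^ i))"
    unfolding spaces_between_adjoin[OF zero_subspace vc(1), symmetric]
    using card_adjoin[OF zero_subspace vc(1,2)] k sub
    by (intro card_spaces_between[OF X adjoin_subspace[OF zero_subspace vc(1)]]) auto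
  moreover have "real (card spaces) =
      (\<Prod>i = 0..<k. (real q ^ N - real q ^ i) / (real q ^ k - real q ^ i))"
    by (simp add: card_spaces q_binomial_def atLeast0LessThan)
  ultimately have "real (card spaces) =
      (real q ^ N - 1) / (real q ^ k - 1) * real (card {U \<in> spaces. v \<in> U})"
    using k by (simp add: prod.atLeast_Suc_lessThan)
  then show ?thesis
    unfolding point_prob_def using q_power_gt_1[of k] q_power_gt_1[of N] k N by simp
qed

text \<open>For \<open>k \<ge> 2\<close> the conditional probability of \<open>w\<close> given
  \<open>v\<close> is \<open>(q ^ k - q) / (q ^ N - q)\<close>, which is at most
  \<open>point_prob\<close>. For \<open>k = 1\<close> a space through \<open>v\<close> is the line
  of \<open>v\<close> and misses \<open>w\<close>.\<close>

lemma card_spaces_containing_2: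
  assumes v: "v \<in> L" and w: "w \<in> L" "w \<notin> adjoin {\<zero>\<^bsub>V\<^esub>} v"
  shows "real (card {U \<in> spaces. v \<in> U \<and> w \<in> U}) \<le> point_prob * real (card {U \<in> spaces. v \<in> U})"
proof -
  let ?S = "adjoin {\<zero>\<^bsub>V\<^esub>} v"
  have vc: "v \<in> carrier V" "v \<notin> {\<zero>\<^bsub>V\<^esub>}" "v \<in> X" using v L X_carrier by auto
  have wc: "w \<in> carrier V" "w \<in> X" using w L X_carrier by auto
  have sub: "?S \<subseteq> X"
    using adjoin_subset_iff[OF zero_subspace X(1) vc(1)] subspaceD(2)[OF X(1)] vc by simp
  have S: "VectorSpace.subspace K ?S V" using adjoin_subspace[OF zero_subspace vc(1)] .
  have cS: "card ?S = q ^ 1" using card_adjoin[OF zero_subspace vc(1,2)] by simp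
  have eq1: "{U \<in> spaces. v \<in> U} = spaces_between ?S X k"
    using spaces_between_adjoin[OF zero_subspace vc(1)] by simp
  have eq2: "{U \<in> spaces. v \<in> U \<and> w \<in> U} = spaces_between (adjoin ?S w) X k"
    using spaces_between_adjoin[OF zero_subspace vc(1)] spaces_between_adjoin[OF S wc(1)] by auto
  have pp: "0 \<le> point_prob" using point_prob_pos by simp
  show ?thesis
  proof (cases "k = 1")
    case True
    have "U = ?S" if "U \<in> spaces_between ?S X k" for U
      using that card_subset_eq[of U ?S] cS True finite_subspace
      unfolding spaces_between_def by auto
    then have "{U \<in> spaces. v \<in> U \<and> w \<in> U} = {}"
      using eq1 w by blast
    then have "real (card {U \<in> spaces. v \<in> U \<and> w \<in> U}) = 0" by (simp only: card.empty of_nat_0)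
    then show ?thesis by (metis mult_nonneg_nonneg of_nat_0_le_iff pp)
  next
    case False
    then have k2: "2 \<le> k" using k by simp
    have subw: "adjoin ?S w \<subseteq> X"
      using adjoin_subset_iff[OF S X(1) wc(1)] sub wc by simp
    have 1: "real (card (spaces_between ?S X k)) =
        (\<Prod>i = 1..<k. (real q ^ N - real q ^ i) / (real q ^ k - real q ^ i))"
      using cS k sub by (intro card_spaces_between[OF X S]) auto
    have 2: "real (card (spaces_between (adjoin ?S w) X k)) =
        (\<Prod>i = 2..<k. (real q ^ N - real q ^ i) / (real q ^ k - real q ^ i))"
      using card_adjoin[OF S wc(1) w(2)] cS k k2 subw
      by (intro card_spaces_between[OF X adjoin_subspace[OF S wc(1)]])
        (auto simp: power2_eq_square)
    have 3: "real (card (spaces_between ?S X k)) =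
        (real q ^ N - real q) / (real q ^ k - real q) * real (card (spaces_between (adjoin ?S w) X k))"
      unfolding 1 2 using k2 by (simp add: prod.atLeast_Suc_lessThan numeral_2_eq_2)
    have pos: "real q ^ k - real q > 0" "real q ^ N - real q > 0"
      using real_power_q_less[of 1 k] real_power_q_less[of 1 N] k2 k by auto
    have "real (card (spaces_between (adjoin ?S w) X k)) =
        (real q ^ k - real q) / (real q ^ N - real q) * real (card (spaces_between ?S X k))"
      unfolding 3 using pos by simp
    moreover have "(real q ^ k - real q) / (real q ^ N - real q) \<le> point_prob"
    proof -
      have qk: "real q ^ k \<le> real q ^ N" using k q_ge_2 by (intro power_increasing) auto
      \<comment> \<open>This product is the difference of the two sides of the cross-multiplied
        inequality.\<close>
      have "(real q - 1) * (real q ^ N - real q ^ k) \<ge> 0"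
        using qk q_ge_2 by (intro mult_nonneg_nonneg) auto
      then have "(real q ^ k - real q) * (real q ^ N - 1) \<le> (real q ^ k - 1) * (real q ^ N - real q)"
        by (simp add: algebra_simps)
      then show ?thesis
        unfolding point_prob_def using pos q_power_gt_1[of N] N by (simp add: divide_simps)
    qed
    ultimately show ?thesis unfolding eq1 eq2 by (metis mult_right_mono of_nat_0_le_iff)
  qed
qed

section \<open>First and second moments of \<open>card (U \<inter> L)\<close>\<close>

lemma sum_card_Int: "(\<Sum>U\<in>spaces. real (card (U \<inter> L))) = real (card L) * point_prob * real (card spaces)"
proof -
  have "(\<Sum>U\<in>spaces. card {v \<in> L. v \<in> U}) = (\<Sum>v\<in>L. card {U \<in> spaces. v \<in> U})"
    by (rule sum_multicount_gen[OF finite_spaces_between finite_L]) simp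
  moreover have "{v \<in> L. v \<in> U} = U \<inter> L" for U by blast
  ultimately have "(\<Sum>U\<in>spaces. real (card (U \<inter> L))) = (\<Sum>v\<in>L. real (card {U \<in> spaces. v \<in> U}))"
    by (metis (no_types, lifting) of_nat_sum sum.cong)
  then show ?thesis using card_spaces_containing by simp
qed

lemma expected_lines_eq: "expected_lines = real (card L) * point_prob / (real q - 1)"
  unfolding expected_lines_def point_prob_def by simp

lemma expected_lines_nonneg: "0 \<le> expected_lines"
  unfolding expected_lines_eq using point_prob_pos q_ge_2 by simp

text \<open>Markov's inequality: a space that meets \<open>L\<close> contains a whole punctured line
  of \<open>L\<close>, hence at least \<open>q - 1\<close> of its points.\<close>

lemma card_meeting_le:
  assumes scaled: "\<And>a v. v \<in> L \<Longrightarrow> a \<in> carrier K \<Longrightarrow> a \<noteq> \<zero>\<^bsub>K\<^esub> \<Longrightarrow> a \<odot>\<^bsub>V\<^esub> v \<in> L"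
  shows "real (card meeting) \<le> expected_lines * real (card spaces)"
proof -
  have ge: "real q - 1 \<le> real (card (U \<inter> L))" if U: "U \<in> meeting" for U
  proof -
    obtain v where v: "v \<in> U" "v \<in> L" using U by (auto simp: meeting_def)
    have sU: "VectorSpace.subspace K U V" using U by (auto simp: meeting_def spaces_between_def)
    have vc: "v \<in> carrier V" "v \<notin> {\<zero>\<^bsub>V\<^esub>}" using v L X_carrier by auto
    have "adjoin {\<zero>\<^bsub>V\<^esub>} v - {\<zero>\<^bsub>V\<^esub>} \<subseteq> U \<inter> L"
    proof
      fix x assume x: "x \<in> adjoin {\<zero>\<^bsub>V\<^esub>} v - {\<zero>\<^bsub>V\<^esub>}"
      then obtain a where a: "a \<in> carrier K" "x = a \<odot>\<^bsub>V\<^esub> v" using vc by (auto simp: adjoin_def)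
      then have "a \<noteq> \<zero>\<^bsub>K\<^esub>" using x vc by auto
      then show "x \<in> U \<inter> L" using a scaled[OF v(2)] subspaceD(4)[OF sU] v by auto
    qed
    then have "card (adjoin {\<zero>\<^bsub>V\<^esub>} v - {\<zero>\<^bsub>V\<^esub>}) \<le> card (U \<inter> L)"
      using finite_L by (intro card_mono) auto
    moreover have "card (adjoin {\<zero>\<^bsub>V\<^esub>} v - {\<zero>\<^bsub>V\<^esub>}) = q - 1"
      using card_adjoin[OF zero_subspace vc] adjoin_superset(1)[OF zero_subspace vc(1)]
      by (subst card_Diff_subset) auto
    ultimately show ?thesis by linarith
  qed
  have "real (card meeting) * (real q - 1) \<le> (\<Sum>U\<in>meeting. real (card (U \<inter> L)))"
    using sum_bounded_below[of meeting "real q - 1"] ge by simp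
  also have "\<dots> \<le> (\<Sum>U\<in>spaces. real (card (U \<inter> L)))"
    by (rule sum_mono2) (auto simp: meeting_def finite_spaces_between)
  finally show ?thesis
    unfolding sum_card_Int expected_lines_eq using q_ge_2 by (simp add: field_simps)
qed

text \<open>Second moment argument: Cauchy--Schwarz for \<open>card (U \<inter> L)\<close>, summed over the spaces \<open>U\<close>
  that meet \<open>L\<close>. Pairs of points on different lines are negatively correlated.\<close>
lemma card_meeting_ge:
  "expected_lines * real (card spaces) \<le> real (card meeting) * (1 + expected_lines)"
proof -
  let ?x = "\<lambda>U. real (card (U \<inter> L))" and ?G = "real (card spaces)" and ?l = "real (card L)"
  \<comment> \<open>This is \<open>(q - 1) * (1 + expected_lines)\<close>; it will bound the second
    moment in terms of the first.\<close>
  let ?M = "(real q - 1) + ?l * point_prob"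
  have fin: "finite spaces" "finite meeting"
    using finite_spaces_between by (auto simp: meeting_def)
  have M: "0 < ?M" using q_ge_2 point_prob_pos by (simp add: add_pos_nonneg)
  have sq: "(\<Sum>U\<in>spaces. (?x U)\<^sup>2) \<le> ?l * (point_prob * ?G * ?M)"
  proof -
    have "(?x U)\<^sup>2 = (\<Sum>v\<in>L. \<Sum>w\<in>L. if v \<in> U \<and> w \<in> U then 1 else 0)" for U
    proof -
      have "?x U = (\<Sum>v\<in>L. if v \<in> U then 1 else 0)"
        using finite_L by (simp add: sum.If_cases Int_commute Collect_mem_eq)
      then have "(?x U)\<^sup>2 = (\<Sum>v\<in>L. \<Sum>w\<in>L. (if v \<in> U then 1 else 0) * (if w \<in> U then 1 else 0))"
        by (simp add: power2_eq_square sum_product)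
      then show ?thesis by (simp add: if_distrib cong: if_cong) (smt (verit) sum.cong)
    qed
    then have "(\<Sum>U\<in>spaces. (?x U)\<^sup>2) =
        (\<Sum>U\<in>spaces. \<Sum>v\<in>L. \<Sum>w\<in>L. if v \<in> U \<and> w \<in> U then 1 else 0)"
      by simp
    also have "\<dots> = (\<Sum>v\<in>L. \<Sum>U\<in>spaces. \<Sum>w\<in>L. if v \<in> U \<and> w \<in> U then 1 else 0)"
      by (rule sum.swap)
    also have "\<dots> = (\<Sum>v\<in>L. \<Sum>w\<in>L. \<Sum>U\<in>spaces. if v \<in> U \<and> w \<in> U then 1 else 0)"
      by (intro sum.cong refl sum.swap)
    also have "\<dots> = (\<Sum>v\<in>L. \<Sum>w\<in>L. real (card {U \<in> spaces. v \<in> U \<and> w \<in> U}))"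
      by (intro sum.cong refl) (simp add: fin(1) flip: sum.inter_filter)
    also have "\<dots> \<le> (\<Sum>v\<in>L. point_prob * ?G * ?M)"
    proof (rule sum_mono)
      fix v assume v: "v \<in> L"
      let ?S = "adjoin {\<zero>\<^bsub>V\<^esub>} v" and ?G1 = "real (card {U \<in> spaces. v \<in> U})"
      have vc: "v \<in> carrier V" "v \<notin> {\<zero>\<^bsub>V\<^esub>}" using v L X_carrier by auto
      have G1: "?G1 = point_prob * ?G" using card_spaces_containing[OF v] .
      have S: "finite ?S" "card (?S - {\<zero>\<^bsub>V\<^esub>}) = q - 1"
        using finite_subspace[OF adjoin_subspace[OF zero_subspace vc(1)]]
          card_adjoin[OF zero_subspace vc] adjoin_superset(1)[OF zero_subspace vc(1)]
        by (auto simp: card_Diff_subset)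
      \<comment> \<open>At most \<open>q - 1\<close> points \<open>w\<close> lie on the line of
        \<open>v\<close>, and they belong to every space through \<open>v\<close>; to all other
        points the negative correlation applies.\<close>
      have "(\<Sum>w\<in>L. real (card {U \<in> spaces. v \<in> U \<and> w \<in> U})) =
          (\<Sum>w\<in>L \<inter> ?S. real (card {U \<in> spaces. v \<in> U \<and> w \<in> U})) +
          (\<Sum>w\<in>L - ?S. real (card {U \<in> spaces. v \<in> U \<and> w \<in> U}))"
        using finite_L by (simp add: sum.Int_Diff)
      also have "\<dots> \<le> (\<Sum>w\<in>L \<inter> ?S. ?G1) + (\<Sum>w\<in>L - ?S. point_prob * ?G1)"
        using card_spaces_containing_2[OF v] fin(1)
        by (intro add_mono sum_mono) (auto intro!: card_mono)
      also have "\<dots> = real (card (L \<inter> ?S)) * ?G1 + real (card (L - ?S)) * (point_prob * ?G1)"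
        by simp
      also have "\<dots> \<le> (real q - 1) * ?G1 + ?l * (point_prob * ?G1)"
      proof (intro add_mono mult_right_mono)
        have "card (L \<inter> ?S) \<le> card (?S - {\<zero>\<^bsub>V\<^esub>})" using L S by (intro card_mono) auto
        then show "real (card (L \<inter> ?S)) \<le> real q - 1" using S q_ge_2 by linarith
        show "real (card (L - ?S)) \<le> ?l" using finite_L by (simp add: card_mono)
      qed (use point_prob_pos in auto)
      also have "\<dots> = point_prob * ?G * ?M" unfolding G1 by (simp add: algebra_simps)
      finally show "(\<Sum>w\<in>L. real (card {U \<in> spaces. v \<in> U \<and> w \<in> U})) \<le> point_prob * ?G * ?M" .
    qed
    also have "\<dots> = ?l * (point_prob * ?G * ?M)" by simp
    finally show ?thesis .
  qed
  have sub: "(\<Sum>U\<in>spaces. ?x U) = (\<Sum>U\<in>meeting. ?x U)"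
    by (rule sum.mono_neutral_right) (auto simp: meeting_def fin)
  have "(?l * point_prob * ?G)\<^sup>2 = (\<Sum>U\<in>meeting. ?x U)\<^sup>2"
    using sub sum_card_Int by simp
  also have "\<dots> \<le> (\<Sum>U\<in>meeting. (?x U)\<^sup>2) * real (card meeting)"
    by (rule sum_squared_le_sum_of_squares)
  also have "\<dots> \<le> (\<Sum>U\<in>spaces. (?x U)\<^sup>2) * real (card meeting)"
    by (intro mult_right_mono sum_mono2) (auto simp: meeting_def fin)
  also have "\<dots> \<le> (?l * (point_prob * ?G * ?M)) * real (card meeting)"
    using sq by (intro mult_right_mono) auto
  finally have "(?l * point_prob * ?G) * (?l * point_prob * ?G) \<le>
      (?l * point_prob * ?G) * (?M * real (card meeting))"
    by (simp add: power2_eq_square algebra_simps)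
  \<comment> \<open>The common factor is the first moment; it is cancelled when positive, and
    otherwise the left-hand side is at most 0.\<close>
  then have main: "?l * point_prob * ?G \<le> ?M * real (card meeting)"
  proof (cases "?l * point_prob * ?G > 0")
    case False
    then have "?l * point_prob * ?G \<le> 0" by simp
    also have "0 \<le> ?M * real (card meeting)" using M by simp
    finally show ?thesis .
  qed (simp only: mult_le_cancel_left_pos)
  have c: "real q - 1 > 0" using q_ge_2 by simp
  have "expected_lines * ?G = ?l * point_prob * ?G / (real q - 1)"
    unfolding expected_lines_eq by simp
  also have "\<dots> \<le> ?M * real (card meeting) / (real q - 1)"
    using main c by (intro divide_right_mono) auto
  also have "\<dots> = real (card meeting) * (?M / (real q - 1))"
    by simp
  also have "?M / (real q - 1) = 1 + expected_lines"
    unfolding expected_lines_eq using c by (simp add: add_divide_distrib)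
  finally show ?thesis .
qed

end

section \<open>Rook placements\<close>

definition placements :: "(nat \<times> nat) set \<Rightarrow> nat \<Rightarrow> (nat \<times> nat) set set" where
  "placements F r = {C. C \<subseteq> F \<and> non_attacking C \<and> card C = r}"

definition left_part :: "(nat \<times> nat) set \<Rightarrow> nat \<Rightarrow> (nat \<times> nat) set" where
  "left_part F j = {x \<in> F. snd x \<le> j}"

text \<open>A rook cancels its own cell, the cells above it and the cells to its right. So a cell is
  affected only by rooks in its own column or further left, which permits recursion over the
  columns.\<close>

definition cancelled :: "(nat \<times> nat) set \<Rightarrow> nat \<times> nat \<Rightarrow> bool" where
  "cancelled C x \<longleftrightarrow>
     (\<exists>y\<in>C. (snd x = snd y \<and> fst x \<le> fst y) \<or> (fst x = fst y \<and> snd y \<le> snd x))"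

lemma rook_inv_eq: "rook_inv C F = card {x \<in> F. \<not> cancelled C x}"
  unfolding rook_inv_def cancelled_def by (rule arg_cong[of _ _ card]) fastforce

text \<open>Such columns, as sets of rows, increase from left to right, so every row used by an
  earlier rook reappears in each later column.\<close>

locale right_justified =
  fixes F :: "(nat \<times> nat) set" and m :: nat
  assumes finite_F: "finite F"
    and cols: "\<And>i j. (i, j) \<in> F \<Longrightarrow> 1 \<le> j \<and> j \<le> m"
    and right: "\<And>i j. (i, j) \<in> F \<Longrightarrow> j < m \<Longrightarrow> (i, j + 1) \<in> F"
begin

abbreviation part :: "nat \<Rightarrow> (nat \<times> nat) set" where
  "part j \<equiv> left_part F j"

definition col :: "nat \<Rightarrow> nat set" where
  "col j = {i. (i, j) \<in> F}"

lemma finite_col: "finite (col j)"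
proof -
  have "col j \<subseteq> fst ` F" unfolding col_def by force
  then show ?thesis using finite_F finite_surj by blast
qed

lemma finite_part: "finite (part j)"
  using finite_F by (simp add: left_part_def)

lemma part_0: "part 0 = {}"
  using cols by (force simp: left_part_def)

lemma part_m: "part m = F"
  using cols by (force simp: left_part_def)

lemma part_Suc: "part (Suc j) = part j \<union> (\<lambda>i. (i, Suc j)) ` col (Suc j)"
  by (auto simp: left_part_def col_def le_Suc_eq image_iff)

lemma part_col_disjoint: "part j \<inter> (\<lambda>i. (i, Suc j)) ` A = {}"
  by (auto simp: left_part_def)

lemma right_le:
  assumes "j \<le> j'" "(i, j) \<in> F" "j' \<le> m"
  shows "(i, j') \<in> F"
  using assms
proof (induction j' rule: dec_induct)
  case (step n)
  then show ?case using right[of i n] by simp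
qed

lemma card_part_Suc: "card (part (Suc j)) = card (part j) + card (col (Suc j))"
proof -
  let ?X = "(\<lambda>i. (i, Suc j)) ` col (Suc j)"
  have 1: "card ?X = card (col (Suc j))"
    by (rule card_image) (simp add: inj_on_def)
  have 2: "finite ?X" using finite_col by (rule finite_imageI)
  have 3: "part j \<inter> ?X = {}" by (rule part_col_disjoint)
  have "card (part j \<union> ?X) = card (part j) + card ?X"
    using finite_part 2 3 by (rule card_Un_disjoint)
  then have "card (part j \<union> ?X) = card (part j) + card (col (Suc j))" unfolding 1 .
  then show ?thesis by (subst part_Suc)
qed

section \<open>Rook placements when one column is added or removed\<close>

lemma finite_placement: "C \<in> placements (part j) r \<Longrightarrow> finite C"
  using finite_part finite_subset by (auto simp: placements_def)

lemma card_rows: "C \<in> placements G r \<Longrightarrow> card (fst ` C) = r"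
  unfolding placements_def non_attacking_def by (auto intro!: card_image inj_onI)

lemma rows_subset:
  assumes "C \<subseteq> part j" "j \<le> j'" "j' \<le> m"
  shows "fst ` C \<subseteq> col j'"
proof
  fix i assume "i \<in> fst ` C"
  then obtain b where "(i, b) \<in> F" "b \<le> j" using assms(1) by (auto simp: left_part_def)
  then show "i \<in> col j'" using right_le[of b j' i] assms by (simp add: col_def)
qed

lemma placement_le_col:
  assumes "C \<in> placements (part j) r" "j \<le> j'" "j' \<le> m"
  shows "r \<le> card (col j')"
  using card_mono[OF finite_col rows_subset[OF _ assms(2,3)], of C] card_rows[OF assms(1)] assms(1)
  by (auto simp: placements_def)

text \<open>Rooks in the last column cancel nothing to their left, so the earlier columns contribute
  as if those rooks were absent.\<close>

lemma rook_inv_part_Suc: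
  assumes "C \<subseteq> part (Suc j)"
  shows "rook_inv C (part (Suc j)) =
    rook_inv (C \<inter> part j) (part j) + card {i \<in> col (Suc j). \<not> cancelled C (i, Suc j)}"
proof -
  have "cancelled C x \<longleftrightarrow> cancelled (C \<inter> part j) x" if "x \<in> part j" for x
    using that assms unfolding cancelled_def left_part_def by fastforce
  then have "{x \<in> part (Suc j). \<not> cancelled C x} = {x \<in> part j. \<not> cancelled (C \<inter> part j) x} \<union>
      (\<lambda>i. (i, Suc j)) ` {i \<in> col (Suc j). \<not> cancelled C (i, Suc j)}"
    unfolding part_Suc by blast
  moreover have "{x \<in> part j. \<not> cancelled (C \<inter> part j) x} \<inter>
      (\<lambda>i. (i, Suc j)) ` {i \<in> col (Suc j). \<not> cancelled C (i, Suc j)} = {}"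
    using part_col_disjoint by blast
  ultimately show ?thesis
    unfolding rook_inv_eq using finite_part finite_col
    by (simp add: card_Un_disjoint card_image inj_on_def)
qed

text \<open>In the new column the \<open>r\<close> earlier rooks cancel exactly the cells of their
  own rows, which leaves \<open>card (col (Suc j)) - r\<close> cells. The additive form avoids
  truncated subtraction.\<close>

lemma placement_no_rook:
  assumes C: "C \<in> placements (part j) r" and j: "Suc j \<le> m"
  shows "C \<in> placements (part (Suc j)) r"
    and "rook_inv C (part (Suc j)) + r = rook_inv C (part j) + card (col (Suc j))"
proof -
  have sub: "C \<subseteq> part j" using C by (simp add: placements_def)
  show "C \<in> placements (part (Suc j)) r" using C by (auto simp: placements_def part_Suc)
  have "{i \<in> col (Suc j). \<not> cancelled C (i, Suc j)} = col (Suc j) - fst ` C"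
    using sub by (force simp: cancelled_def left_part_def)
  moreover have "card (col (Suc j) - fst ` C) = card (col (Suc j)) - r"
    using rows_subset[OF sub _ j] card_rows[OF C] finite_placement[OF C]
    by (subst card_Diff_subset) auto
  moreover have "r \<le> card (col (Suc j))" using placement_le_col[OF C _ j] by simp
  moreover have "C \<inter> part j = C" using sub by blast
  moreover have "C \<subseteq> part (Suc j)" using sub by (auto simp: left_part_def)
  ultimately show "rook_inv C (part (Suc j)) + r = rook_inv C (part j) + card (col (Suc j))"
    using rook_inv_part_Suc[of C j] by simp
qed

text \<open>A rook in the lowest row of the next column that is still free cancels all of that column.\<close>
lemma placement_add_rook:
  assumes C: "C \<in> placements (part j) r" and j: "Suc j \<le> m" and r: "r < card (col (Suc j))"
  obtains C' where "C' \<in> placements (part (Suc j)) (Suc r)"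
    "rook_inv C' (part (Suc j)) = rook_inv C (part j)"
proof -
  have sub: "C \<subseteq> part j" using C by (simp add: placements_def)
  let ?R = "col (Suc j) - fst ` C"
  have fR: "finite ?R" using finite_col by simp
  have "?R \<noteq> {}"
  proof
    assume "?R = {}"
    then have "card (col (Suc j)) \<le> card (fst ` C)"
      using finite_placement[OF C] by (intro card_mono) auto
    with card_rows[OF C] r show False by simp
  qed
  define i where "i = Max ?R"
  have i: "i \<in> ?R" "\<And>a. a \<in> ?R \<Longrightarrow> a \<le> i"
    unfolding i_def using Max_in[OF fR \<open>?R \<noteq> {}\<close>] Max_ge[OF fR] by auto
  let ?C = "insert (i, Suc j) C"
  have new: "(i, Suc j) \<notin> C" using sub by (auto simp: left_part_def)
  have "non_attacking ?C"
    using C i sub unfolding placements_def non_attacking_def left_part_def by force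
  then have 1: "?C \<in> placements (part (Suc j)) (Suc r)"
    using C new finite_placement[OF C] i by (auto simp: placements_def part_Suc)
  have "{a \<in> col (Suc j). \<not> cancelled ?C (a, Suc j)} = {}"
  proof -
    \<comment> \<open>Rows of earlier rooks are cancelled from the left; the free rows lie at or
      above the new rook.\<close>
    have "cancelled ?C (a, Suc j)" if a: "a \<in> col (Suc j)" for a
    proof (cases "a \<in> fst ` C")
      case True
      then show ?thesis using sub by (force simp: cancelled_def left_part_def)
    next
      case False
      then show ?thesis using i(2)[of a] a by (force simp: cancelled_def)
    qed
    then show ?thesis by blast
  qed
  then have "card {a \<in> col (Suc j). \<not> cancelled ?C (a, Suc j)} = 0" by (simp only: card.empty)
  moreover have "?C \<inter> part j = C" using sub by (auto simp: left_part_def)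
  ultimately have "rook_inv ?C (part (Suc j)) = rook_inv C (part j)"
    using rook_inv_part_Suc[of ?C j] 1 by (simp add: placements_def)
  with 1 that show ?thesis by blast
qed

text \<open>No two rooks share the last column, so dropping that column removes at most one
  rook.\<close>

lemma placement_restrict:
  assumes C: "C \<in> placements (part (Suc j)) r" and j: "Suc j \<le> m"
  shows "rook_inv (C \<inter> part j) (part j) \<le> rook_inv C (part (Suc j))"
    and "C \<inter> part j = C \<or> r \<noteq> 0 \<and> C \<inter> part j \<in> placements (part j) (r - 1)"
proof -
  have sub: "C \<subseteq> part (Suc j)" using C by (simp add: placements_def)
  show "rook_inv (C \<inter> part j) (part j) \<le> rook_inv C (part (Suc j))"
    using rook_inv_part_Suc[OF sub] by simp
  show "C \<inter> part j = C \<or> r \<noteq> 0 \<and> C \<inter> part j \<in> placements (part j) (r - 1)"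
  proof (cases "C \<subseteq> part j")
    case False
    then obtain i where i: "(i, Suc j) \<in> C" using sub by (auto simp: part_Suc)
    have "C - {(i, Suc j)} = C \<inter> part j"
    proof -
      have "x = (i, Suc j)" if "x \<in> C" "x \<notin> part j" for x
      proof -
        have "snd x = Suc j" using that sub by (auto simp: part_Suc)
        then show ?thesis using C i that unfolding placements_def non_attacking_def by force
      qed
      moreover have "(i, Suc j) \<notin> part j" by (simp add: left_part_def)
      ultimately show ?thesis by blast
    qed
    moreover have "card (C - {(i, Suc j)}) = r - 1"
      using C i by (simp add: placements_def)
    moreover have "r \<noteq> 0"
    proof
      assume "r = 0"
      then have "card C = 0" using C by (simp add: placements_def)
      then show False using i finite_placement[OF C] by simp
    qed
    ultimately show ?thesis
      using C by (auto simp: placements_def non_attacking_def)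
  qed auto
qed

lemma placement_restrict_cases:
  assumes C: "C \<in> placements (part (Suc j)) r" and j: "Suc j \<le> m"
  obtains (same) "C \<in> placements (part j) r"
  | (rook) r' where "r = Suc r'" "r' < card (col (Suc j))" "C \<inter> part j \<in> placements (part j) r'"
proof (cases "C \<inter> part j = C")
  case True
  then show ?thesis using C same by (auto simp: placements_def)
next
  case False
  then have "r \<noteq> 0" "C \<inter> part j \<in> placements (part j) (r - 1)"
    using placement_restrict[OF C j] by auto
  moreover have "r \<le> card (col (Suc j))" using placement_le_col[OF C _ j] by simp
  ultimately show ?thesis using rook[of "r - 1"] by simp
qed

text \<open>\<open>P\<close> witnesses that one more rook fits. If \<open>C\<close> leaves the last
  column empty, a rook is added there at no cost. Otherwise the induction hypothesis adds a rook in
  the earlier columns, and the last column again receives one at no cost.\<close>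

lemma placement_extend_part:
  assumes "j \<le> m" "C \<in> placements (part j) s" "P \<in> placements (part j) (Suc s)"
  shows "\<exists>C' \<in> placements (part j) (Suc s). rook_inv C' (part j) \<le> rook_inv C (part j)"
  using assms
proof (induction j arbitrary: C P s)
  case 0
  then show ?case by (auto simp: placements_def part_0)
next
  case (Suc j)
  have j: "Suc j \<le> m" "j \<le> m" using Suc.prems by auto
  have s: "s < card (col (Suc j))" using placement_le_col[OF Suc.prems(3) _ j(1)] by simp
  have res: "rook_inv (C \<inter> part j) (part j) \<le> rook_inv C (part (Suc j))"
    using placement_restrict[OF Suc.prems(2) j(1)] by simp
  show ?case
    using Suc.prems(2) j(1)
  proof (cases rule: placement_restrict_cases)
    case same
    obtain C' where "C' \<in> placements (part (Suc j)) (Suc s)"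
        "rook_inv C' (part (Suc j)) = rook_inv C (part j)"
      using placement_add_rook[OF same j(1) s] .
    moreover have "C \<inter> part j = C" using same by (auto simp: placements_def)
    ultimately show ?thesis using res by (intro bexI[of _ C']) auto
  next
    case (rook s')
    \<comment> \<open>\<open>P\<close> yields \<open>s\<close> rooks in the earlier columns: its
      restriction if it has a rook in the last column, and any \<open>s\<close> of its rooks if
      not.\<close>
    have "\<exists>P'. P' \<in> placements (part j) s"
      using Suc.prems(3) j(1)
    proof (cases rule: placement_restrict_cases)
      case same
      then obtain P' where "P' \<subseteq> P" "card P' = s"
        by (metis (mono_tags, lifting) le_add2 mem_Collect_eq obtain_subset_with_card_n placements_def plus_1_eq_Suc)
      with same have "P' \<in> placements (part j) s"
        unfolding placements_def non_attacking_def by blast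
      then show ?thesis ..
    qed auto
    then obtain P' where "P' \<in> placements (part j) (Suc s')" using rook(1) by auto
    then obtain D where D: "D \<in> placements (part j) s"
        "rook_inv D (part j) \<le> rook_inv (C \<inter> part j) (part j)"
      using Suc.IH[OF j(2) rook(3)] rook(1) by auto
    obtain C' where "C' \<in> placements (part (Suc j)) (Suc s)"
        "rook_inv C' (part (Suc j)) = rook_inv D (part j)"
      using placement_add_rook[OF D(1) j(1) s] .
    with D(2) res show ?thesis by (intro bexI[of _ C']) auto
  qed
qed

text \<open>Rooks are added one at a time, with subsets of \<open>P\<close> as witnesses that they
  fit. This carries the lower bound \<open>tau F (d - 1)\<close> over to placements with fewer than
  \<open>d - 1\<close> rooks.\<close>

lemma placement_extend:
  assumes "P \<in> placements F r" "C \<in> placements F s" "s \<le> r"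
  shows "\<exists>C' \<in> placements F r. rook_inv C' F \<le> rook_inv C F"
  using assms(3,1)
proof (induction arbitrary: P rule: dec_induct)
  case base
  then show ?case using assms(2) by auto
next
  case (step r)
  obtain P' where "P' \<subseteq> P" "card P' = r"
    using step.prems by (metis (mono_tags, lifting) le_add2 mem_Collect_eq obtain_subset_with_card_n placements_def plus_1_eq_Suc)
  with step.prems have "P' \<in> placements F r"
    unfolding placements_def non_attacking_def by blast
  then obtain C' where C': "C' \<in> placements F r" "rook_inv C' F \<le> rook_inv C F"
    using step.IH by blast
  obtain D where "D \<in> placements F (Suc r)" "rook_inv D F \<le> rook_inv C' F"
    using placement_extend_part[of m C' r P] step.prems C' by (auto simp: part_m)
  with C' show ?case by (intro bexI[of _ D]) auto
qed

end

section \<open>The trailing degree as a minimum over placements\<close>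

lemma coeff_q_rook_poly:
  assumes "finite F"
  shows "coeff (q_rook_poly F r) i = int (card {C \<in> placements F r. rook_inv C F = i})"
proof -
  have eq: "{C. C \<subseteq> F \<and> non_attacking C \<and> card C = r} = placements F r"
    by (simp add: placements_def)
  have fin: "finite (placements F r)"
    using assms by (auto simp: placements_def intro: finite_subset[of _ "Pow F"])
  show ?thesis
    unfolding q_rook_poly_def eq
    by (simp add: coeff_sum fin flip: sum.inter_filter)
qed

text \<open>The coefficients count placements, so none cancel and the trailing degree is the least
  value of \<open>rook_inv\<close>; \<open>P\<close> ensures that the polynomial is nonzero.\<close>

lemma tau_props:
  assumes fin: "finite F" and P: "P \<in> placements F r"
  shows "\<exists>C \<in> placements F r. rook_inv C F = tau F r"
    and "C \<in> placements F r \<Longrightarrow> tau F r \<le> rook_inv C F"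
proof -
  have fin': "finite (placements F r)"
    using assms by (auto simp: placements_def intro: finite_subset[of _ "Pow F"])
  have iff: "coeff (q_rook_poly F r) i \<noteq> 0 \<longleftrightarrow> (\<exists>C \<in> placements F r. rook_inv C F = i)" for i
    unfolding coeff_q_rook_poly[OF fin] using fin' by auto
  have tau: "tau F r = (LEAST i. \<exists>C \<in> placements F r. rook_inv C F = i)"
    unfolding tau_def trailing_degree_def iff ..
  show "\<exists>C \<in> placements F r. rook_inv C F = tau F r"
    unfolding tau by (rule LeastI_ex) (use P in blast)
  show "tau F r \<le> rook_inv C F" if "C \<in> placements F r"
    unfolding tau by (rule Least_le) (use that in blast)
qed

section \<open>Counting families of columns by rank\<close>

context finite_vectorspace
begin

text \<open>A matrix with \<open>j\<close> columns and rank \<open>r\<close>, seen as the sequence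
  of its columns; the rank is encoded through the cardinality of the column span.\<close>

definition families :: "(nat \<Rightarrow> 'c set) \<Rightarrow> nat \<Rightarrow> nat \<Rightarrow> (nat \<Rightarrow> 'c) set" where
  "families W j r = {f \<in> PiE {1..j} W. card (span (f ` {1..j})) = q ^ r}"

lemma power_q_inject: "q ^ i = q ^ j \<longleftrightarrow> i = j"
  using q_ge_2 by simp

lemma families_0: "card (families W 0 r) = (if r = 0 then 1 else 0)"
proof -
  have "families W 0 r = (if r = 0 then {\<lambda>x. undefined} else {})"
    using power_q_inject[of 0 r] by (auto simp: families_def span_empty)
  then show ?thesis by simp
qed

lemma finite_families:
  assumes "\<And>j. W j \<subseteq> carrier V"
  shows "finite (families W j r)"
proof -
  have "finite (PiE {1..j} W)"
    using finite_subset[OF assms finite_vectors] by (intro finite_PiE) auto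
  then show ?thesis by (simp add: families_def)
qed

lemma card_span_Suc:
  assumes "\<And>j. W j \<subseteq> carrier V" "g \<in> PiE {1..j} W" "y \<in> W (Suc j)"
  shows "card (span ((g(Suc j := y)) ` {1..Suc j})) =
    (if y \<in> span (g ` {1..j}) then card (span (g ` {1..j})) else q * card (span (g ` {1..j})))"
proof -
  have "(g(Suc j := y)) ` {1..Suc j} = insert y (g ` {1..j})"
    by (auto simp: atLeastAtMostSuc_conv image_iff)
  moreover have "g ` {1..j} \<subseteq> carrier V" "y \<in> carrier V" using assms by auto
  ultimately show ?thesis by (simp add: card_span_insert)
qed

text \<open>A new column either lies in the span of the earlier ones and keeps the rank, or lies
  outside and raises it by one.\<close>

lemma families_Suc:
  assumes W: "\<And>j. W j \<subseteq> carrier V"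
  shows "families W (Suc j) r = (\<lambda>(g, y). g(Suc j := y)) `
    ((SIGMA g:families W j r. W (Suc j) \<inter> span (g ` {1..j})) \<union>
     (if r = 0 then {} else SIGMA g:families W j (r - 1). W (Suc j) - span (g ` {1..j})))"
    (is "_ = ?u ` (?A \<union> ?B)")
proof -
  let ?T = "PiE {1..j} W \<times> W (Suc j)"
  have PiE: "PiE {1..Suc j} W = ?u ` ?T"
  proof -
    have "{1..Suc j} = insert (Suc j) {1..j}" by auto
    then show ?thesis by (simp add: PiE_insert_eq image_def) blast
  qed
  have "(g, y) \<in> ?A \<union> ?B \<longleftrightarrow> card (span ((?u (g, y)) ` {1..Suc j})) = q ^ r"
    if gy: "(g, y) \<in> ?T" for g y
  proof -
    have gy': "g \<in> PiE {1..j} W" "y \<in> W (Suc j)" using gy by auto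
    have q0: "q > 0" using q_ge_2 by simp
    have pos: "card (span (g ` {1..j})) > 0"
    proof -
      have "g ` {1..j} \<subseteq> carrier V" using W gy' by auto
      then have sp: "VectorSpace.subspace K (span (g ` {1..j})) V" by (rule span_is_subspace)
      show ?thesis using finite_subspace[OF sp] subspaceD(2)[OF sp] by (auto simp: card_gt_0_iff)
    qed
    have cs: "card (span ((?u (g, y)) ` {1..Suc j})) =
        (if y \<in> span (g ` {1..j}) then card (span (g ` {1..j})) else q * card (span (g ` {1..j})))"
      using card_span_Suc[OF W gy'] by (simp only: prod.case)
    show ?thesis
      unfolding cs using gy' pos q_ge_2 by (cases r) (auto simp: families_def)
  qed
  moreover have "?A \<union> ?B \<subseteq> ?T" by (auto simp: families_def split: if_splits)
  ultimately have "?A \<union> ?B = {x \<in> ?T. card (span ((?u x) ` {1..Suc j})) = q ^ r}"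
    by blast
  then have "?u ` (?A \<union> ?B) = {f \<in> ?u ` ?T. card (span (f ` {1..Suc j})) = q ^ r}"
    by blast
  then show ?thesis unfolding families_def[of W "Suc j"] PiE by simp
qed

text \<open>The earlier \<open>W i\<close> lie in \<open>W (Suc j)\<close>, so the earlier columns
  span a subspace of it. Hence \<open>q ^ r\<close> choices keep rank \<open>r\<close>, and
  \<open>q ^ c - q ^ (r - 1)\<close> choices reach it from rank \<open>r - 1\<close>.\<close>

lemma card_families_Suc:
  assumes sub: "\<And>j. VectorSpace.subspace K (W j) V"
    and incr: "\<And>i. i \<in> {1..j} \<Longrightarrow> W i \<subseteq> W (Suc j)"
    and c: "card (W (Suc j)) = q ^ c"
  shows "card (families W (Suc j) r) = q ^ r * card (families W j r) +
    (if r = 0 then 0 else (q ^ c - q ^ (r - 1)) * card (families W j (r - 1)))"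
proof -
  let ?u = "\<lambda>(g, y). g(Suc j := y)"
  let ?A = "SIGMA g:families W j r. W (Suc j) \<inter> span (g ` {1..j})"
  let ?B = "if r = 0 then {} else SIGMA g:families W j (r - 1). W (Suc j) - span (g ` {1..j})"
  have W: "W i \<subseteq> carrier V" for i using subspaceD(1)[OF sub] .
  have fW: "finite (W (Suc j))" using finite_subspace[OF sub] .
  have ff: "finite (families W j s)" for s using finite_families[OF W] .
  have span: "span (g ` {1..j}) \<subseteq> W (Suc j)" "card (span (g ` {1..j})) = q ^ s"
    if "g \<in> families W j s" for g s
  proof -
    have "g ` {1..j} \<subseteq> W (Suc j)" using that incr by (fastforce simp: families_def)
    then show "span (g ` {1..j}) \<subseteq> W (Suc j)"
      using span_is_subset[OF _ is_module[OF sub]] by blast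
    show "card (span (g ` {1..j})) = q ^ s" using that by (simp add: families_def)
  qed
  have "inj_on ?u (?A \<union> ?B)"
  proof (rule inj_onI, clarify)
    fix g y g' y'
    assume mem: "(g, y) \<in> ?A \<union> ?B" "(g', y') \<in> ?A \<union> ?B" and eq: "g(Suc j := y) = g'(Suc j := y')"
    have "g \<in> PiE {1..j} W" "g' \<in> PiE {1..j} W"
      using mem by (auto simp: families_def split: if_splits)
    then have "g (Suc j) = undefined" "g' (Suc j) = undefined" by (auto simp: PiE_def extensional_def)
    then show "g = g' \<and> y = y'" using eq by (metis fun_upd_idem_iff fun_upd_same fun_upd_upd)
  qed
  then have "card (families W (Suc j) r) = card (?A \<union> ?B)"
    unfolding families_Suc[OF W] by (rule card_image)
  also have "\<dots> = card ?A + card ?B"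
  proof (rule card_Un_disjoint)
    show "finite ?A" "finite ?B" using ff fW by auto
    show "?A \<inter> ?B = {}" by auto
  qed
  also have "card ?A = q ^ r * card (families W j r)"
  proof -
    have "card (W (Suc j) \<inter> span (g ` {1..j})) = q ^ r" if "g \<in> families W j r" for g
      using span[OF that] by (simp add: Int_absorb1)
    then show ?thesis using ff fW by (simp add: card_SigmaI)
  qed
  also have "card ?B = (if r = 0 then 0 else (q ^ c - q ^ (r - 1)) * card (families W j (r - 1)))"
  proof -
    have "card (W (Suc j) - span (g ` {1..j})) = q ^ c - q ^ s" if "g \<in> families W j s" for g s
      using span[OF that] c fW finite_subset by (subst card_Diff_subset) auto
    then show ?thesis using ff fW by (simp add: card_SigmaI)
  qed
  finally show ?thesis .
qed

end

text \<open>Couples the linear algebra to the diagram: by \<open>card_W\<close> the number of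
  candidates for column \<open>j\<close> is governed by its height, so that rank counts and rook
  placements obey matching recursions.\<close>

locale ferrers_columns = finite_vectorspace K V + right_justified F m
  for K :: "('a, 'b) ring_scheme" and V :: "('a, 'c) module"
    and F :: "(nat \<times> nat) set" and m :: nat +
  fixes W :: "nat \<Rightarrow> 'c set"
  assumes W: "\<And>j. VectorSpace.subspace K (W j) V"
    and incr: "\<And>i j. i \<le> j \<Longrightarrow> 1 \<le> i \<Longrightarrow> j \<le> m \<Longrightarrow> W i \<subseteq> W j"
    and card_W: "\<And>j. j \<in> {1..m} \<Longrightarrow> card (W j) = q ^ card (col j)"
begin

lemma card_families_Suc':
  assumes j: "Suc j \<le> m"
  shows "card (families W (Suc j) r) = q ^ r * card (families W j r) +
    (if r = 0 then 0 else (q ^ card (col (Suc j)) - q ^ (r - 1)) * card (families W j (r - 1)))"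
  using W j card_W[of "Suc j"] incr[of _ "Suc j"]
  by (intro card_families_Suc) auto

text \<open>Follows one placement: a column with a rook raises the rank, a column without one keeps
  it. Against all \<open>q ^ c\<close> choices, raising the rank loses at most the factor
  \<open>1 - 1 / q\<close>.\<close>

lemma card_families_ge:
  assumes "j \<le> m" "C \<in> placements (part j) r"
  shows "(1 - 1 / real q) ^ j * real q ^ card (part j) \<le>
    real (card (families W j r)) * real q ^ rook_inv C (part j)"
  using assms
proof (induction j arbitrary: C r)
  case 0
  then show ?case by (auto simp: placements_def part_0 families_0 rook_inv_def)
next
  case (Suc j)
  let ?c = "card (col (Suc j))" and ?e = "1 - 1 / real q"
  have j: "Suc j \<le> m" "j \<le> m" using Suc.prems by auto
  have e: "0 \<le> ?e" "?e \<le> 1" using q_ge_2 by auto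
  have q1: "1 \<le> real q" using q_ge_2 by simp
  show ?case
    using Suc.prems(2) j(1)
  proof (cases rule: placement_restrict_cases)
    case same
    have "?e ^ Suc j * real q ^ card (part (Suc j)) =
        ?e * (?e ^ j * real q ^ card (part j)) * real q ^ ?c"
      by (simp add: card_part_Suc power_add)
    \<comment> \<open>Keeping the rank loses nothing; the factor \<open>1 - 1 / q\<close> is bounded
      by 1 only to match the other case.\<close>
    also have "\<dots> \<le> 1 * (real (card (families W j r)) * real q ^ rook_inv C (part j)) * real q ^ ?c"
      using e by (intro mult_right_mono[OF mult_mono[OF _ Suc.IH[OF j(2) same]]]) auto
    also have "\<dots> = real (card (families W j r)) * real q ^ (rook_inv C (part j) + ?c)"
      by (simp add: power_add)
    also have "\<dots> = real (q ^ r * card (families W j r)) * real q ^ rook_inv C (part (Suc j))"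
      unfolding placement_no_rook(2)[OF same j(1), symmetric] by (simp add: power_add)
    also have "\<dots> \<le> real (card (families W (Suc j) r)) * real q ^ rook_inv C (part (Suc j))"
      unfolding card_families_Suc'[OF j(1)] by (intro mult_right_mono) auto
    finally show ?thesis .
  next
    case (rook r')
    have qc: "?e * real q ^ ?c \<le> real (q ^ ?c - q ^ r')"
    proof -
      \<comment> \<open>The worst case is \<open>r' = d\<close>, one below the height, and it gives
        exactly the factor \<open>1 - 1 / q\<close>.\<close>
      obtain d where d: "?c = Suc d" using rook(2) by (cases ?c) auto
      have "real q ^ r' \<le> real q ^ d" using rook(2) d q_ge_2 by (intro power_increasing) auto
      moreover have "q ^ r' \<le> q ^ ?c" using rook(2) q_ge_2 by (intro power_increasing) auto
      moreover have "?e * real q ^ ?c = real q ^ ?c - real q ^ d"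
        using q_ge_2 d by (simp add: field_simps)
      ultimately show ?thesis by (simp add: of_nat_diff)
    qed
    have "?e ^ Suc j * real q ^ card (part (Suc j)) =
        (?e * real q ^ ?c) * (?e ^ j * real q ^ card (part j))"
      by (simp add: card_part_Suc power_add)
    also have "\<dots> \<le> real (q ^ ?c - q ^ r') *
        (real (card (families W j r')) * real q ^ rook_inv (C \<inter> part j) (part j))"
      using e by (intro mult_mono[OF qc Suc.IH[OF j(2) rook(3)]]) auto
    also have "\<dots> \<le> real (q ^ ?c - q ^ r') *
        (real (card (families W j r')) * real q ^ rook_inv C (part (Suc j)))"
      using placement_restrict(1)[OF Suc.prems(2) j(1)] q1
      by (intro mult_left_mono power_increasing) auto
    also have "\<dots> = real ((q ^ ?c - q ^ r') * card (families W j r')) * real q ^ rook_inv C (part (Suc j))"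
      by simp
    also have "\<dots> \<le> real (card (families W (Suc j) r)) * real q ^ rook_inv C (part (Suc j))"
      unfolding card_families_Suc'[OF j(1)] rook(1) by (intro mult_right_mono) auto
    finally show ?thesis .
  qed
qed

text \<open>If there is no placement at all, \<open>t\<close> is arbitrary, so that the left-hand side must vanish.\<close>
lemma card_families_le:
  assumes "j \<le> m" "\<And>C. C \<in> placements (part j) r \<Longrightarrow> t \<le> rook_inv C (part j)"
  shows "card (families W j r) * q ^ t \<le> 2 ^ j * q ^ card (part j)"
  using assms
proof (induction j arbitrary: r t)
  case 0
  have "t \<le> 0" if "r = 0"
    using 0(2)[of "{}"] that by (simp add: placements_def part_0 non_attacking_def rook_inv_def)
  then show ?case by (simp add: families_0 part_0)
next
  case (Suc j)
  let ?c = "card (col (Suc j))"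
  have j: "Suc j \<le> m" "j \<le> m" using Suc.prems by auto
  have q1: "1 \<le> q" using q_ge_2 by simp
  \<comment> \<open>Keeping the rank and raising it are bounded by the same quantity, so each column
    doubles the constant.\<close>
  have keep: "q ^ r * card (families W j r) * q ^ t \<le> 2 ^ j * q ^ card (part (Suc j))"
  proof -
    have "q ^ r * card (families W j r) * q ^ t = card (families W j r) * q ^ (t + r)"
      by (simp add: power_add)
    \<comment> \<open>The induction hypothesis is applied to \<open>t + r - ?c\<close>; truncated
      subtraction can only enlarge the exponent.\<close>
    also have "\<dots> \<le> card (families W j r) * q ^ (t + r - ?c + ?c)"
      using q1 by (intro mult_left_mono power_increasing) auto
    also have "\<dots> = card (families W j r) * q ^ (t + r - ?c) * q ^ ?c"
      by (simp add: power_add)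
    also have "\<dots> \<le> 2 ^ j * q ^ card (part j) * q ^ ?c"
    proof (intro mult_right_mono Suc.IH j(2))
      fix C assume C: "C \<in> placements (part j) r"
      show "t + r - ?c \<le> rook_inv C (part j)"
        using Suc.prems(2)[OF placement_no_rook(1)[OF C j(1)]] placement_no_rook(2)[OF C j(1)] by linarith
    qed simp
    finally show ?thesis by (simp add: card_part_Suc power_add)
  qed
  have add: "(if r = 0 then 0 else (q ^ ?c - q ^ (r - 1)) * card (families W j (r - 1))) * q ^ t
      \<le> 2 ^ j * q ^ card (part (Suc j))"
  proof (cases "r \<noteq> 0 \<and> r - 1 < ?c")
    case True
    then obtain r' where r: "r = Suc r'" "r' < ?c" by (cases r) auto
    have IH: "card (families W j r') * q ^ t \<le> 2 ^ j * q ^ card (part j)"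
    proof (intro Suc.IH j(2))
      fix C assume C: "C \<in> placements (part j) r'"
      show "t \<le> rook_inv C (part j)"
        using placement_add_rook[OF C j(1) r(2)] Suc.prems(2) r(1) by metis
    qed
    have "(q ^ ?c - q ^ r') * (card (families W j r') * q ^ t) \<le> q ^ ?c * (2 ^ j * q ^ card (part j))"
      by (rule mult_le_mono[OF diff_le_self IH])
    then show ?thesis using r by (simp add: card_part_Suc power_add algebra_simps)
  next
    \<comment> \<open>Either \<open>r = 0\<close>, or \<open>r - 1\<close> is at least the height of
      the column and the truncated difference vanishes.\<close>
    case False
    have "q ^ ?c - q ^ (r - 1) = 0" if "r \<noteq> 0"
      using False that q1 by (simp add: power_increasing)
    then show ?thesis by simp
  qed
  show ?case
    unfolding card_families_Suc'[OF j(1)] using add_mono[OF keep add]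
    by (simp add: algebra_simps)
qed

end

section \<open>Matrices supported on a Ferrers diagram\<close>

lemma ferrers_right_justified:
  assumes "ferrers_diagram n m F"
  shows "right_justified F m"
proof
  show "finite F" using assms finite_subset unfolding ferrers_diagram_def by blast
  show "1 \<le> j \<and> j \<le> m" if "(i, j) \<in> F" for i j
    using assms that unfolding ferrers_diagram_def by auto
  show "(i, j + 1) \<in> F" if "(i, j) \<in> F" "j < m" for i j
    using assms that unfolding ferrers_diagram_def by blast
qed

lemma ferrers_up:
  assumes F: "ferrers_diagram n m F" and i: "1 \<le> i'" "i' \<le> i" and "(i, j) \<in> F"
  shows "(i', j) \<in> F"
  using i(2) assms(4)
proof (induction i rule: dec_induct)
  case (step i)
  then have "(Suc i - 1, j) \<in> F"
    using F i(1) unfolding ferrers_diagram_def by (metis Suc_le_eq le_imp_less_Suc le_trans less_Suc_eq_le)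
  then show ?case using step.IH by simp
qed

text \<open>Positivity of \<open>kappa_j\<close> yields a column taller than \<open>j\<close> among
  the first \<open>m + 1 + j - d\<close>; its cell in row \<open>j + 1\<close> can be moved right to
  the last of these columns.\<close>

lemma kappa_ge_1_cell:
  assumes F: "ferrers_diagram n m F" and kappa: "1 \<le> kappa m F d" and j: "j < d"
  shows "(j + 1, m + 1 + j - d) \<in> F" "1 \<le> m + 1 + j - d"
proof -
  interpret right_justified F m using ferrers_right_justified[OF F] .
  have "kappa m F d \<le> kappa_j m F d j"
    unfolding kappa_def using j by (intro Min_le) auto
  with kappa have "kappa_j m F d j \<noteq> 0" by simp
  then obtain t where t: "t \<in> {1..m + 1 + j - d}" "col_height F t - j \<noteq> 0"
    unfolding kappa_j_def by (meson sum.neutral)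
  show "1 \<le> m + 1 + j - d" using t by auto
  have "(j + 1, t) \<in> F"
  proof (rule ccontr)
    assume no: "(j + 1, t) \<notin> F"
    have "{i. (i, t) \<in> F} \<subseteq> {1..j}"
    proof
      fix i assume i: "i \<in> {i. (i, t) \<in> F}"
      then have "1 \<le> i" using F unfolding ferrers_diagram_def by auto
      moreover have "i \<le> j" using ferrers_up[OF F, of "j + 1" i t] i no by fastforce
      ultimately show "i \<in> {1..j}" by simp
    qed
    then have "card {i. (i, t) \<in> F} \<le> j" using card_mono[of "{1..j}"] by fastforce
    with t show False by (simp add: col_height_def)
  qed
  then show "(j + 1, m + 1 + j - d) \<in> F"
    using right_le[of t "m + 1 + j - d"] t j by auto
qed

text \<open>The cells found for \<open>j < r\<close> lie on a diagonal, so they do not attack each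
  other. With \<open>r = d - 1\<close> this makes \<open>tau F (d - 1)\<close> the trailing degree
  of a nonzero polynomial.\<close>

lemma kappa_ge_1_placement:
  assumes F: "ferrers_diagram n m F" and kappa: "1 \<le> kappa m F d" and r: "r \<le> d"
  shows "\<exists>P. P \<in> placements F r"
proof
  let ?f = "\<lambda>j. (j + 1, m + 1 + j - d)"
  have "inj_on ?f {..<r}" by (auto simp: inj_on_def)
  then have "card (?f ` {..<r}) = r" by (simp add: card_image)
  moreover have "non_attacking (?f ` {..<r})"
  proof -
    \<comment> \<open>Both column indices are at least 1, so truncated subtraction cannot merge
      them.\<close>
    have "m + 1 + j - d \<noteq> m + 1 + j' - d" if "j < r" "j' < r" "j \<noteq> j'" for j j'
      using kappa_ge_1_cell(2)[OF F kappa, of j] kappa_ge_1_cell(2)[OF F kappa, of j'] that r by linarith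
    then show ?thesis unfolding non_attacking_def by force
  qed
  moreover have "?f ` {..<r} \<subseteq> F" using kappa_ge_1_cell(1)[OF F kappa] r by auto
  ultimately show "?f ` {..<r} \<in> placements F r" by (simp add: placements_def)
qed

text \<open>The functions on \<open>S\<close> that vanish off \<open>A\<close>, written as a
  dependent product so that their number is a product. Matrices and single columns are both
  instances.\<close>

definition supported :: "('a, 'b) ring_scheme \<Rightarrow> 'z set \<Rightarrow> 'z set \<Rightarrow> ('z \<Rightarrow> 'a) set" where
  "supported K S A = PiE S (\<lambda>x. if x \<in> A then carrier K else {\<zero>\<^bsub>K\<^esub>})"

lemma card_supported:
  assumes "finite S"
  shows "card (supported K S A) = card (carrier K) ^ card (S \<inter> A)"
  unfolding supported_def using assms
  by (simp add: card_PiE if_distrib prod.If_cases cong: if_cong)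

locale ferrers_matrices =
  fixes K :: "('a, 'b) ring_scheme" and n m d :: nat and F :: "(nat \<times> nat) set"
  assumes field_K: "field K" and finite_K: "finite (carrier K)"
    and diagram: "ferrers_diagram n m F"
    and d: "2 \<le> d" "d \<le> n"
    and kappa: "1 \<le> kappa m F d"
begin

section \<open>Matrices, their columns and their ranks\<close>

abbreviation "cells \<equiv> {1..n} \<times> {1..m}"
definition "matrices = ring.func_space K cells"
definition "columns = ring.func_space K {1..n}"
abbreviation "qK \<equiv> card (carrier K)"

lemma ring_K: "ring K"
  using field_K field.is_ring by blast

lemma finite_vectorspace_func_space:
  assumes "finite S"
  shows "finite_vectorspace K (ring.func_space K S)"
proof -
  interpret field K by (rule field_K)
  have "Module.module K (func_space S)" by (rule func_space_is_module)
  then have "vectorspace K (func_space S)" using field_K by (simp add: vectorspace_def)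
  moreover have "finite (carrier (func_space S))"
    using assms finite_K by (simp add: func_space_def finite_PiE)
  ultimately show ?thesis
    using finite_K by (simp add: finite_vectorspace_def finite_vectorspace_axioms_def)
qed

lemma mat_space_eq: "mat_space K n m = matrices"
  by (simp only: mat_space_def matrices_def)

sublocale M: finite_vectorspace K matrices
  unfolding matrices_def by (rule finite_vectorspace_func_space) simp

sublocale C: finite_vectorspace K columns
  unfolding columns_def by (rule finite_vectorspace_func_space) simp

lemma func_space_sel:
  "carrier (ring.func_space K S) = S \<rightarrow>\<^sub>E carrier K"
  "\<zero>\<^bsub>ring.func_space K S\<^esub> = (\<lambda>x\<in>S. \<zero>\<^bsub>K\<^esub>)"
  "f \<oplus>\<^bsub>ring.func_space K S\<^esub> g = (\<lambda>x\<in>S. f x \<oplus>\<^bsub>K\<^esub> g x)"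
  "a \<odot>\<^bsub>ring.func_space K S\<^esub> f = (\<lambda>x\<in>S. a \<otimes>\<^bsub>K\<^esub> f x)"
  by (simp_all add: ring.func_space_def[OF ring_K])

lemma supported_mem: "f \<in> supported K S A \<longleftrightarrow>
    f \<in> S \<rightarrow>\<^sub>E carrier K \<and> (\<forall>x \<in> S - A. f x = \<zero>\<^bsub>K\<^esub>)"
proof (cases "f \<in> extensional S")
  case True
  then show ?thesis
    using ring.ring_simprules(2)[OF ring_K]
    by (simp add: supported_def PiE_iff) (auto split: if_splits)
qed (simp add: supported_def PiE_iff)

lemma supported_subspace:
  assumes "finite S"
  shows "VectorSpace.subspace K (supported K S A) (ring.func_space K S)"
proof -
  interpret V: finite_vectorspace K "ring.func_space K S"
    by (rule finite_vectorspace_func_space[OF assms])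
  show ?thesis
  proof (rule V.subspaceI)
    show "supported K S A \<subseteq> carrier (ring.func_space K S)"
      unfolding func_space_sel subset_iff supported_mem by blast
  qed (auto simp: supported_mem func_space_sel PiE_iff)
qed

lemma supported_mats_eq: "supported_mats K n m F = supported K cells F"
  unfolding supported_mats_def mat_space_def func_space_sel(1)
  by (rule Set.set_eqI) (simp only: mem_Collect_eq supported_mem)

definition W :: "nat \<Rightarrow> (nat \<Rightarrow> 'a) set" where
  "W j = supported K {1..n} {i. (i, j) \<in> F}"

sublocale right_justified F m
  by (rule ferrers_right_justified[OF diagram])

lemma W_subspace: "VectorSpace.subspace K (W j) columns"
  unfolding W_def columns_def by (rule supported_subspace) simp

lemma W_mono:
  assumes "i \<le> j" "j \<le> m"
  shows "W i \<subseteq> W j"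
proof
  fix v assume v: "v \<in> W i"
  have "v x = \<zero>\<^bsub>K\<^esub>" if "x \<in> {1..n} - {a. (a, j) \<in> F}" for x
  proof -
    have "x \<in> {1..n} - {a. (a, i) \<in> F}" using that right_le[OF assms(1) _ assms(2)] by blast
    with v show ?thesis unfolding W_def supported_mem by blast
  qed
  with v show "v \<in> W j" unfolding W_def supported_mem by blast
qed

lemma card_W_eq: "card (W j) = qK ^ card (col j)"
proof -
  have "{1..n} \<inter> {i. (i, j) \<in> F} = col j"
    using diagram by (auto simp: ferrers_diagram_def col_def)
  then show ?thesis unfolding W_def by (simp add: card_supported)
qed

sublocale ferrers_columns K columns F m W
  by (intro ferrers_columns.intro ferrers_columns_axioms.intro
      C.finite_vectorspace_axioms right_justified_axioms W_subspace W_mono card_W_eq)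

lemma F_cells: "F \<subseteq> cells"
  using diagram by (simp add: ferrers_diagram_def)

lemma card_supported_mats: "card (supported_mats K n m F) = qK ^ card F"
  unfolding supported_mats_eq using card_supported[of cells K F] F_cells by (simp add: Int_absorb1)

definition column_map :: "(nat \<times> nat \<Rightarrow> 'a) \<Rightarrow> nat \<Rightarrow> nat \<Rightarrow> 'a" where
  "column_map M = (\<lambda>j\<in>{1..m}. mat_col n M j)"

text \<open>Passing to columns turns the support condition on a matrix into independent conditions
  \<open>W j\<close> on its columns.\<close>

lemma bij_column_map: "bij_betw column_map (supported_mats K n m F) (PiE {1..m} W)"
proof (rule bij_betw_byWitness[where f' = "\<lambda>g. \<lambda>(i, j)\<in>cells. g j i"])
  show "\<forall>M\<in>supported_mats K n m F. (\<lambda>(i, j)\<in>cells. column_map M j i) = M"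
  proof
    fix M assume "M \<in> supported_mats K n m F"
    then have "M \<in> extensional cells" by (auto simp: supported_mats_eq supported_mem PiE_def)
    then show "(\<lambda>(i, j)\<in>cells. column_map M j i) = M"
      by (intro extensionalityI[of _ cells]) (auto simp: column_map_def mat_col_def)
  qed
  show "\<forall>g\<in>PiE {1..m} W. column_map (\<lambda>(i, j)\<in>cells. g j i) = g"
  proof
    fix g assume g: "g \<in> PiE {1..m} W"
    have "mat_col n (\<lambda>(i, j)\<in>cells. g j i) j = g j" if "j \<in> {1..m}" for j
    proof -
      have "g j \<in> extensional {1..n}"
        using g that by (auto simp: W_def supported_mem PiE_def Pi_def)
      then show ?thesis
        using that by (intro extensionalityI[of _ "{1..n}"]) (auto simp: mat_col_def)
    qed
    then have "column_map (\<lambda>(i, j)\<in>cells. g j i) j = g j" for j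
      using PiE_arb[OF g, of j] by (cases "j \<in> {1..m}") (auto simp: column_map_def)
    then show "column_map (\<lambda>(i, j)\<in>cells. g j i) = g" by blast
  qed
  show "column_map ` supported_mats K n m F \<subseteq> PiE {1..m} W"
    by (auto simp: supported_mats_eq supported_mem column_map_def mat_col_def W_def PiE_iff)
  show "(\<lambda>g. \<lambda>(i, j)\<in>cells. g j i) ` PiE {1..m} W \<subseteq> supported_mats K n m F"
    by (auto simp: supported_mats_eq supported_mem W_def PiE_iff)
qed

lemma mat_col_closed:
  assumes "M \<in> carrier matrices"
  shows "mat_col n M ` {1..m} \<subseteq> carrier columns"
  using assms by (auto simp: matrices_def columns_def func_space_sel mat_col_def PiE_iff)

lemma card_column_span:
  assumes "M \<in> carrier matrices"
  shows "card (C.span (mat_col n M ` {1..m})) = qK ^ mat_rank K n m M"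
  unfolding mat_rank_def Let_def columns_def[symmetric]
  by (rule C.card_subspace[OF C.span_is_subspace[OF mat_col_closed[OF assms]]])

lemma supported_mats_carrier: "supported_mats K n m F \<subseteq> carrier matrices"
  by (simp add: supported_mats_def mat_space_eq)

lemma card_rank_eq:
  "card {M \<in> supported_mats K n m F. mat_rank K n m M = r} = card (C.families W m r)"
proof -
  have eq: "mat_rank K n m M = r \<longleftrightarrow> card (C.span (column_map M ` {1..m})) = qK ^ r"
    if "M \<in> supported_mats K n m F" for M
  proof -
    have "column_map M ` {1..m} = mat_col n M ` {1..m}" by (auto simp: column_map_def)
    then show ?thesis using card_column_span[of M] supported_mats_carrier that C.power_q_inject by auto
  qed
  have im: "PiE {1..m} W = column_map ` supported_mats K n m F"
    using bij_betw_imp_surj_on[OF bij_column_map] by simp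
  have "C.families W m r = column_map ` {M \<in> supported_mats K n m F. mat_rank K n m M = r}"
    unfolding C.families_def im using eq by auto
  moreover have "inj_on column_map {M \<in> supported_mats K n m F. mat_rank K n m M = r}"
    by (rule inj_on_subset[OF bij_betw_imp_inj_on[OF bij_column_map]]) auto
  ultimately show ?thesis by (simp add: card_image)
qed

text \<open>The columns of the multiple lie in the column span of \<open>M\<close>. This inequality
  keeps \<open>low_rank\<close> closed under nonzero scalars.\<close>

lemma mat_rank_smult:
  assumes M: "M \<in> carrier matrices" and a: "a \<in> carrier K"
  shows "mat_rank K n m (a \<odot>\<^bsub>matrices\<^esub> M) \<le> mat_rank K n m M"
proof -
  let ?S = "C.span (mat_col n M ` {1..m})"
  have aM: "a \<odot>\<^bsub>matrices\<^esub> M \<in> carrier matrices" using M a by simp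
  have S: "VectorSpace.subspace K ?S columns" by (rule C.span_is_subspace[OF mat_col_closed[OF M]])
  have "mat_col n (a \<odot>\<^bsub>matrices\<^esub> M) j = a \<odot>\<^bsub>columns\<^esub> mat_col n M j" if "j \<in> {1..m}" for j
    using that by (auto simp: matrices_def columns_def mat_col_def func_space_sel restrict_def)
  then have "mat_col n (a \<odot>\<^bsub>matrices\<^esub> M) ` {1..m} \<subseteq> ?S"
    using C.in_own_span[OF mat_col_closed[OF M]] C.subspaceD(4)[OF S a] by auto
  then have "C.span (mat_col n (a \<odot>\<^bsub>matrices\<^esub> M) ` {1..m}) \<subseteq> ?S"
    using C.span_is_subset[OF _ C.is_module[OF S]] by blast
  then have "qK ^ mat_rank K n m (a \<odot>\<^bsub>matrices\<^esub> M) \<le> qK ^ mat_rank K n m M"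
    using card_mono[OF C.finite_subspace[OF S]] card_column_span[OF M] card_column_span[OF aM] by metis
  then show ?thesis using C.q_ge_2 by simp
qed

lemma mat_rank_zero: "mat_rank K n m \<zero>\<^bsub>matrices\<^esub> = 0"
proof -
  have "mat_col n \<zero>\<^bsub>matrices\<^esub> ` {1..m} \<subseteq> {\<zero>\<^bsub>columns\<^esub>}"
    by (auto simp: matrices_def columns_def mat_col_def func_space_sel restrict_def)
  moreover have Z: "VectorSpace.subspace K {\<zero>\<^bsub>columns\<^esub>} columns" by (rule C.subspaceI) auto
  ultimately have "C.span (mat_col n \<zero>\<^bsub>matrices\<^esub> ` {1..m}) \<subseteq> {\<zero>\<^bsub>columns\<^esub>}"
    using C.span_is_subset[OF _ C.is_module[OF Z]] by blast
  then have "card (C.span (mat_col n \<zero>\<^bsub>matrices\<^esub> ` {1..m})) \<le> card {\<zero>\<^bsub>columns\<^esub>}"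
    by (rule card_mono[rotated]) simp
  then have le: "qK ^ mat_rank K n m \<zero>\<^bsub>matrices\<^esub> \<le> 1"
    unfolding card_column_span[OF M.M.zero_closed] by simp
  show ?thesis
  proof (rule ccontr)
    assume "mat_rank K n m \<zero>\<^bsub>matrices\<^esub> \<noteq> 0"
    then have "qK \<le> qK ^ mat_rank K n m \<zero>\<^bsub>matrices\<^esub>"
      using C.q_ge_2 by (intro self_le_power) auto
    then show False using le C.q_ge_2 by linarith
  qed
qed

section \<open>The number of nonzero matrices of rank below \<open>d\<close>\<close>

definition low_rank :: "(nat \<times> nat \<Rightarrow> 'a) set" where
  "low_rank = {M \<in> supported_mats K n m F. M \<noteq> \<zero>\<^bsub>matrices\<^esub> \<and> mat_rank K n m M < d}"

abbreviation "t \<equiv> tau F (d - 1)"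

lemma finite_supported_mats: "finite (supported_mats K n m F)"
  using supported_mats_carrier M.finite_vectors finite_subset by blast

lemma obtain_placement: obtains P where "P \<in> placements F (d - 1)"
  using kappa_ge_1_placement[OF diagram kappa, of "d - 1"] by auto

text \<open>Matrices of rank exactly \<open>d - 1\<close>, counted along a placement with least
  \<open>rook_inv\<close>, already give the bound.\<close>

lemma card_low_rank_ge:
  "(1 - 1 / real qK) ^ m * real qK ^ card F \<le> real (card low_rank) * real qK ^ t"
proof -
  obtain P where P: "P \<in> placements F (d - 1)" by (rule obtain_placement)
  obtain C where C: "C \<in> placements F (d - 1)" "rook_inv C F = t"
    using tau_props(1)[OF finite_F P] by blast
  \<comment> \<open>As \<open>d \<ge> 2\<close>, the rank \<open>d - 1\<close> is positive and
    excludes the zero matrix.\<close>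
  have "{M \<in> supported_mats K n m F. mat_rank K n m M = d - 1} \<subseteq> low_rank"
    using d mat_rank_zero by (auto simp: low_rank_def)
  then have "card (C.families W m (d - 1)) \<le> card low_rank"
    unfolding card_rank_eq[symmetric]
    using finite_supported_mats by (intro card_mono) (auto simp: low_rank_def)
  then have "real (card (C.families W m (d - 1))) * real qK ^ t \<le> real (card low_rank) * real qK ^ t"
    by (intro mult_right_mono) auto
  then show ?thesis using card_families_ge[of m C "d - 1"] C by (simp add: part_m)
qed

text \<open>Placements of \<open>r < d\<close> rooks have \<open>rook_inv\<close> at least
  \<open>t\<close>, so each of the \<open>d\<close> possible ranks contributes at most
  \<open>2 ^ m * q ^ (card F - t)\<close> matrices.\<close>

lemma card_low_rank_le:
  "real (card low_rank) * real qK ^ t \<le> real (d * 2 ^ m) * real qK ^ card F"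
proof -
  obtain P where P: "P \<in> placements F (d - 1)" by (rule obtain_placement)
  have le: "card (C.families W m r) * qK ^ t \<le> 2 ^ m * qK ^ card F" if r: "r < d" for r
  proof -
    have "t \<le> rook_inv C F" if C: "C \<in> placements F r" for C
    proof -
      have "r \<le> d - 1" using r by simp
      then obtain C' where "C' \<in> placements F (d - 1)" "rook_inv C' F \<le> rook_inv C F"
        using placement_extend[OF P C] by blast
      then show ?thesis using tau_props(2)[OF finite_F P, of C'] by simp
    qed
    then show ?thesis using card_families_le[of m r t] by (simp add: part_m)
  qed
  have "low_rank \<subseteq> (\<Union>r<d. {M \<in> supported_mats K n m F. mat_rank K n m M = r})"
    by (auto simp: low_rank_def)
  then have "card low_rank \<le> card (\<Union>r<d. {M \<in> supported_mats K n m F. mat_rank K n m M = r})"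
    using finite_supported_mats by (intro card_mono) auto
  also have "\<dots> \<le> (\<Sum>r<d. card (C.families W m r))"
    unfolding card_rank_eq[symmetric] by (rule card_UN_le) simp
  finally have "card low_rank * qK ^ t \<le> (\<Sum>r<d. card (C.families W m r)) * qK ^ t" by simp
  also have "\<dots> = (\<Sum>r<d. card (C.families W m r) * qK ^ t)" by (simp add: sum_distrib_right)
  also have "\<dots> \<le> (\<Sum>r<d. 2 ^ m * qK ^ card F)" using le by (intro sum_mono) auto
  finally have "card low_rank * qK ^ t \<le> d * 2 ^ m * qK ^ card F" by simp
  then have "real (card low_rank * qK ^ t) \<le> real (d * 2 ^ m * qK ^ card F)" by (rule of_nat_mono)
  then show ?thesis by simp
qed

section \<open>Bounds on the density for a fixed field\<close>

lemma card_F_ge_2: "2 \<le> card F"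
proof -
  have "{(1, 1), (n, m)} \<subseteq> F" using diagram by (simp add: ferrers_diagram_def)
  then have "card {(1, 1), (n, m)} \<le> card F" using finite_F by (intro card_mono)
  moreover have "n \<noteq> 1" using d by simp
  ultimately show ?thesis by auto
qed

text \<open>The codes of dimension \<open>k\<close> are the \<open>k\<close>-spaces of supported
  matrices that avoid \<open>low_rank\<close>, so the density is the probability of missing that
  set.\<close>

lemma code_density_bounds:
  assumes k: "1 \<le> k" "k \<le> card F"
  defines "E \<equiv> real (card low_rank) * (real qK ^ k - 1) / ((real qK - 1) * (real qK ^ card F - 1))"
  shows "1 - E \<le> code_density K n m F k d" "code_density K n m F k d \<le> 1 / (1 + E)"
    "0 \<le> code_density K n m F k d" "0 \<le> E"
proof -
  interpret R: random_subspace K matrices "supported_mats K n m F" low_rank "card F" k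
  proof (intro random_subspace.intro random_subspace_axioms.intro)
    show "VectorSpace.subspace K (supported_mats K n m F) matrices"
      unfolding supported_mats_eq matrices_def by (rule supported_subspace) simp
    show "low_rank \<subseteq> supported_mats K n m F - {\<zero>\<^bsub>matrices\<^esub>}"
      unfolding low_rank_def by blast
  qed (fact M.finite_vectorspace_axioms card_supported_mats card_F_ge_2 k)+
  have E: "E = R.expected_lines" unfolding E_def R.expected_lines_def ..
  show E0: "0 \<le> E" unfolding E by (rule R.expected_lines_nonneg)
  let ?G = "real (card R.spaces)" and ?B = "real (card R.meeting)"
  have "{C. ferrers_code K n m F d C \<and> subspace_dim K (mat_space K n m) C = k} = R.spaces - R.meeting"
  proof (rule Set.set_eqI, unfold mem_Collect_eq)
    fix U
    show "ferrers_code K n m F d U \<and> subspace_dim K (mat_space K n m) U = k \<longleftrightarrow> U \<in> R.spaces - R.meeting"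
    proof (cases "VectorSpace.subspace K U matrices")
      case True
      have "subspace_dim K (mat_space K n m) U = k \<longleftrightarrow> card U = qK ^ k"
        using M.card_subspace[OF True] M.power_q_inject by (simp add: mat_space_eq)
      moreover have "{\<zero>\<^bsub>matrices\<^esub>} \<subseteq> U" using M.subspaceD(2)[OF True] by simp
      moreover have "U \<inter> low_rank = {} \<longleftrightarrow> (\<forall>M\<in>U. M \<noteq> \<zero>\<^bsub>matrices\<^esub> \<longrightarrow> d \<le> mat_rank K n m M)"
        if "U \<subseteq> supported_mats K n m F"
        using that by (auto simp: low_rank_def not_less)
      moreover have "U \<in> R.spaces - R.meeting \<longleftrightarrow>
          {\<zero>\<^bsub>matrices\<^esub>} \<subseteq> U \<and> U \<subseteq> supported_mats K n m F \<and> card U = qK ^ k \<and> U \<inter> low_rank = {}"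
        unfolding R.meeting_def M.spaces_between_def using True by blast
      ultimately show ?thesis
        unfolding ferrers_code_def mat_space_eq using True by blast
    next
      case False
      then show ?thesis unfolding ferrers_code_def M.spaces_between_def mat_space_eq by blast
    qed
  qed
  moreover have "card (R.spaces - R.meeting) = card R.spaces - card R.meeting"
    using M.finite_spaces_between by (intro card_Diff_subset) (auto simp: R.meeting_def)
  moreover have BG: "card R.meeting \<le> card R.spaces"
    using M.finite_spaces_between by (intro card_mono) (auto simp: R.meeting_def)
  ultimately have D: "code_density K n m F k d = (?G - ?B) / ?G"
    unfolding code_density_def R.card_spaces[symmetric] by (simp add: of_nat_diff)
  have G: "0 < ?G" by (rule R.card_spaces_pos)
  show "0 \<le> code_density K n m F k d" unfolding D using BG by simp
  have "?B \<le> E * ?G" unfolding E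
  proof (rule R.card_meeting_le)
    \<comment> \<open>Closure of \<open>low_rank\<close> under nonzero scalars, which the union
      bound over lines requires.\<close>
    fix a M assume M: "M \<in> low_rank" and a: "a \<in> carrier K" "a \<noteq> \<zero>\<^bsub>K\<^esub>"
    have Mc: "M \<in> carrier matrices" using M supported_mats_carrier by (auto simp: low_rank_def)
    have "a \<odot>\<^bsub>matrices\<^esub> M \<in> supported_mats K n m F"
      using M.subspaceD(4)[OF R.X(1) a(1)] M by (simp add: low_rank_def)
    moreover have "a \<odot>\<^bsub>matrices\<^esub> M \<noteq> \<zero>\<^bsub>matrices\<^esub>"
    proof
      assume z: "a \<odot>\<^bsub>matrices\<^esub> M = \<zero>\<^bsub>matrices\<^esub>"
      have "M = inv\<^bsub>K\<^esub> a \<odot>\<^bsub>matrices\<^esub> \<zero>\<^bsub>matrices\<^esub>" by (rule M.mult_inverse[OF a(1) Mc z a(2)])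
      also have "\<dots> = \<zero>\<^bsub>matrices\<^esub>" using a by (simp add: M.field_Units)
      finally show False using M by (simp add: low_rank_def)
    qed
    ultimately show "a \<odot>\<^bsub>matrices\<^esub> M \<in> low_rank"
      using mat_rank_smult[OF Mc a(1)] M by (simp add: low_rank_def)
  qed
  then show "1 - E \<le> code_density K n m F k d" unfolding D using G by (simp add: field_simps)
  \<comment> \<open>This says that \<open>?B / ?G\<close> is at least \<open>E / (1 + E)\<close>,
    whose complement is the claimed bound.\<close>
  have "E * ?G \<le> ?B * (1 + E)" unfolding E by (rule R.card_meeting_ge)
  then show "code_density K n m F k d \<le> 1 / (1 + E)" unfolding D using G E0 by (simp add: field_simps)
qed

text \<open>\<open>x\<close> is \<open>q ^ (k - 1 - t)\<close>, written as a quotient because the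
  exponent may be negative. In the upper bound the coefficient of \<open>x\<close> tends to 1, as
  the case \<open>k = t + 1\<close> requires.\<close>

lemma code_density_asymptotic_bounds:
  assumes k: "1 \<le> k" "k \<le> card F"
  defines "x \<equiv> real qK ^ k / real qK ^ (t + 1)"
  shows "1 - 4 * real (d * 2 ^ m) * x \<le> code_density K n m F k d"
    and "code_density K n m F k d \<le> 1 / (1 + (1 - 1 / real qK) ^ (m + 1) * x)"
proof -
  let ?q = "real qK" and ?L = "real (card low_rank)" and ?N = "card F"
  let ?E = "?L * (?q ^ k - 1) / ((?q - 1) * (?q ^ ?N - 1))"
  note B = code_density_bounds[OF k]
  have q2: "2 \<le> ?q" using C.q_ge_2 by simp
  have qN: "2 \<le> ?q ^ ?N"
    by (rule order_trans[OF q2 self_le_power]) (use q2 card_F_ge_2 in auto)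
  have qt: "0 < ?q ^ t" using q2 by simp
  have qk: "2 \<le> ?q ^ k"
    by (rule order_trans[OF q2 self_le_power]) (use q2 k in auto)
  have e: "0 \<le> 1 - 1 / ?q" using q2 by simp
  \<comment> \<open>The factor 4 comes from \<open>q - 1 \<ge> q / 2\<close> and
    \<open>q ^ N - 1 \<ge> q ^ N / 2\<close>.\<close>
  have "?E \<le> ?L * ?q ^ k / ((?q / 2) * (?q ^ ?N / 2))"
    using q2 qN qk by (intro frac_le mult_mono mult_left_mono mult_nonneg_nonneg mult_pos_pos) auto
  also have "\<dots> = 4 * (?L * ?q ^ t) * ?q ^ k / (?q * ?q ^ t * ?q ^ ?N)"
    using q2 by simp
  also have "\<dots> \<le> 4 * (real (d * 2 ^ m) * ?q ^ ?N) * ?q ^ k / (?q * ?q ^ t * ?q ^ ?N)"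
    using card_low_rank_le q2 by (intro divide_right_mono mult_right_mono mult_left_mono) auto
  also have "\<dots> = 4 * real (d * 2 ^ m) * x"
    unfolding x_def using q2 by simp
  finally show "1 - 4 * real (d * 2 ^ m) * x \<le> code_density K n m F k d" using B(1) by linarith
  \<comment> \<open>One factor \<open>1 - 1 / q\<close> pays for passing from \<open>q ^ k\<close>
    to \<open>q ^ k - 1\<close>; the other \<open>m\<close> come from the count of low-rank
    matrices.\<close>
  have "(1 - 1 / ?q) ^ (m + 1) * x = ((1 - 1 / ?q) ^ m * ?q ^ ?N) * ((1 - 1 / ?q) * ?q ^ k) / (?q ^ t * (?q * ?q ^ ?N))"
    unfolding x_def using q2 by (simp add: mult_ac)
  also have "\<dots> \<le> (?L * ?q ^ t) * (?q ^ k - 1) / (?q ^ t * (?q * ?q ^ ?N))"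
  proof (intro divide_right_mono mult_mono[OF card_low_rank_ge])
    have "?q \<le> ?q ^ k" by (rule self_le_power) (use q2 k in auto)
    then show "(1 - 1 / ?q) * ?q ^ k \<le> ?q ^ k - 1" using q2 by (simp add: field_simps)
  qed (use e q2 in auto)
  also have "\<dots> = ?L * (?q ^ k - 1) / (?q * ?q ^ ?N)"
    using q2 by simp
  also have "\<dots> \<le> ?E"
    using q2 qN qk by (intro divide_left_mono mult_mono mult_nonneg_nonneg mult_pos_pos) auto
  finally have le: "(1 - 1 / ?q) ^ (m + 1) * x \<le> ?E" .
  have "0 \<le> (1 - 1 / ?q) ^ (m + 1) * x" unfolding x_def using e q2 by (intro mult_nonneg_nonneg) auto
  then have "1 / (1 + ?E) \<le> 1 / (1 + (1 - 1 / ?q) ^ (m + 1) * x)"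
    using le by (intro divide_left_mono) auto
  then show "code_density K n m F k d \<le> 1 / (1 + (1 - 1 / ?q) ^ (m + 1) * x)"
    using B(2) by linarith
qed

end

section \<open>Asymptotics\<close>

lemma eventually_prime_powers:
  assumes "\<And>q. primepow q \<Longrightarrow> q \<ge> N \<Longrightarrow> P q"
  shows "eventually P prime_powers_at_top"
  unfolding prime_powers_at_top_def eventually_inf_principal eventually_at_top_linorder
  using assms by auto

lemma tendsto_prime_powers:
  assumes "f \<longlonglongrightarrow> l"
  shows "(f \<longlongrightarrow> l) prime_powers_at_top"
  using tendsto_mono[OF inf_le1 assms] by (simp add: prime_powers_at_top_def)

theorem theorem3p6:
  fixes K :: "nat \<Rightarrow> ('a, 'b) ring_scheme"
    and F :: "(nat \<times> nat) set"
    and n m d k :: nat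
  assumes field: "\<And>q. primepow q \<Longrightarrow> field (K q)"
    and card_field: "\<And>q. primepow q \<Longrightarrow> card (carrier (K q)) = q"
    and diagram: "ferrers_diagram n m F"
    and d: "2 \<le> d" "d \<le> n"
    and k: "1 \<le> k" "k \<le> card F"
    and kappa: "1 \<le> kappa m F d"
  shows "(k \<le> tau F (d - 1) \<longrightarrow>
            ((\<lambda>q. code_density (K q) n m F k d) \<longlongrightarrow> 1) prime_powers_at_top) \<and>
         (tau F (d - 1) + 2 \<le> k \<longrightarrow>
            ((\<lambda>q. code_density (K q) n m F k d) \<longlongrightarrow> 0) prime_powers_at_top) \<and>
         (k = tau F (d - 1) + 1 \<longrightarrow>
            Limsup prime_powers_at_top (\<lambda>q. ereal (code_density (K q) n m F k d)) \<le> ereal (1 / 2))"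
proof -
  let ?D = "\<lambda>q. code_density (K q) n m F k d" and ?t = "tau F (d - 1)"
  define x where "x = (\<lambda>q. real q ^ k / real q ^ (?t + 1))"
  define A where "A = 4 * real (d * 2 ^ m)"
  define e where "e = (\<lambda>q. (1 - 1 / real q) ^ (m + 1))"
  have lower: "1 - A * x q \<le> ?D q" and upper: "?D q \<le> 1 / (1 + e q * x q)"
    and nonneg: "0 \<le> ?D q" and le1: "?D q \<le> 1" if q: "primepow q" for q
  proof -
    \<comment> \<open>An infinite set has \<open>card\<close> equal to 0, whereas a prime power is
      positive.\<close>
    have "finite (carrier (K q))"
      using card_field[OF q] primepow_gt_0_nat[OF q] by (metis card.infinite less_numeral_extra(3))
    then interpret ferrers_matrices "K q" n m d F
      using field[OF q] diagram d kappa by (intro ferrers_matrices.intro)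
    show "1 - A * x q \<le> ?D q" "?D q \<le> 1 / (1 + e q * x q)"
      using code_density_asymptotic_bounds[OF k] card_field[OF q]
      by (simp_all add: A_def x_def e_def)
    show "0 \<le> ?D q" using code_density_bounds(3)[OF k] .
    show "?D q \<le> 1"
      by (rule order_trans[OF code_density_bounds(2)[OF k]]) (use code_density_bounds(4)[OF k] in simp)
  qed
  have e_lim: "e \<longlonglongrightarrow> 1"
    unfolding e_def using lim_1_over_n
    by (auto intro!: tendsto_eq_intros)
  have A0: "0 \<le> A" by (simp add: A_def)
  have e0: "0 \<le> e q" if "q \<ge> 1" for q using that by (simp add: e_def)
  have "(?D \<longlongrightarrow> 1) prime_powers_at_top" if kt: "k \<le> ?t"
  proof (rule tendsto_sandwich)
    show "\<forall>\<^sub>F q in prime_powers_at_top. 1 - A / real q \<le> ?D q"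
    proof (rule eventually_prime_powers[of 1])
      fix q :: nat assume q: "primepow q" "1 \<le> q"
      have "x q * real q = real q ^ k / real q ^ ?t" using q by (simp add: x_def)
      also have "\<dots> \<le> 1" using q kt by (simp add: power_increasing)
      finally have "x q \<le> 1 / real q" using q by (simp add: field_simps)
      then have "A * x q \<le> A * (1 / real q)" using A0 by (rule mult_left_mono)
      then show "1 - A / real q \<le> ?D q" using lower[OF q(1)] by simp
    qed
    show "\<forall>\<^sub>F q in prime_powers_at_top. ?D q \<le> 1"
      using le1 by (rule eventually_prime_powers[of 0])
    show "((\<lambda>q. 1 - A / real q) \<longlongrightarrow> 1) prime_powers_at_top"
      using lim_const_over_n[of A] by (intro tendsto_prime_powers) (auto intro!: tendsto_eq_intros)
  qed simp
  moreover have "(?D \<longlongrightarrow> 0) prime_powers_at_top" if kt: "?t + 2 \<le> k"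
  proof (rule tendsto_sandwich)
    show "\<forall>\<^sub>F q in prime_powers_at_top. 0 \<le> ?D q"
      using nonneg by (rule eventually_prime_powers[of 0])
    show "\<forall>\<^sub>F q in prime_powers_at_top. ?D q \<le> 2 ^ (m + 1) / real q"
    proof (rule eventually_prime_powers[of 2])
      fix q :: nat assume q: "primepow q" "2 \<le> q"
      have "real q * real q ^ (?t + 1) \<le> real q ^ k"
        using q kt power_increasing[of "?t + 2" k "real q"] by simp
      then have xq: "real q \<le> x q" using q by (simp add: x_def pos_le_divide_eq)
      \<comment> \<open>For \<open>q \<ge> 2\<close> this keeps \<open>e q\<close> above a positive
        constant, so the upper bound decays like \<open>1 / q\<close>.\<close>
      have "(1 / 2 :: real) \<le> 1 - 1 / real q" using q by (simp add: field_simps)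
      then have "(1 / 2) ^ (m + 1) \<le> e q" unfolding e_def by (intro power_mono) auto
      then have "(1 / 2) ^ (m + 1) * real q \<le> e q * x q"
        using xq q e0[of q] by (intro mult_mono) auto
      moreover have "0 \<le> e q * x q" using e0[of q] xq q by (intro mult_nonneg_nonneg) auto
      ultimately have "1 / (1 + e q * x q) \<le> 1 / ((1 / 2) ^ (m + 1) * real q)"
        using q by (intro divide_left_mono) (auto intro!: mult_pos_pos add_pos_nonneg)
      also have "\<dots> = 2 ^ (m + 1) / real q" by (simp add: power_one_over)
      finally show "?D q \<le> 2 ^ (m + 1) / real q" using upper[OF q(1)] by linarith
    qed
    show "((\<lambda>q. 2 ^ (m + 1) / real q) \<longlongrightarrow> 0) prime_powers_at_top"
      using lim_const_over_n by (rule tendsto_prime_powers)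
  qed simp
  moreover have "Limsup prime_powers_at_top (\<lambda>q. ereal (?D q)) \<le> ereal (1 / 2)" if kt: "k = ?t + 1"
    unfolding Limsup_le_iff
  proof (intro allI impI)
    fix y :: ereal assume y: "ereal (1 / 2) < y"
    \<comment> \<open>For \<open>k = ?t + 1\<close> the quantity \<open>x q\<close> is 1, so
      \<open>1 / (1 + e q)\<close> bounds the density and falls below any \<open>y\<close> greater
      than \<open>1 / 2\<close>.\<close>
    have "((\<lambda>q. ereal (1 / (1 + e q))) \<longlongrightarrow> ereal (1 / 2)) prime_powers_at_top"
      using e_lim by (intro tendsto_prime_powers) (auto intro!: tendsto_eq_intros)
    then have "\<forall>\<^sub>F q in prime_powers_at_top. ereal (1 / (1 + e q)) < y"
      using y by (rule order_tendstoD(2))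
    moreover have "\<forall>\<^sub>F q in prime_powers_at_top. ?D q \<le> 1 / (1 + e q)"
    proof (rule eventually_prime_powers[of 1])
      fix q :: nat assume q: "primepow q" "1 \<le> q"
      have "x q = 1" using q kt by (simp add: x_def)
      then show "?D q \<le> 1 / (1 + e q)" using upper[OF q(1)] by simp
    qed
    ultimately show "\<forall>\<^sub>F q in prime_powers_at_top. ereal (?D q) < y"
      by eventually_elim (metis ereal_less_eq(3) le_less_trans)
  qed
  ultimately show ?thesis by blast
qed

end
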